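(* Let $r\ge 1$, $m_0\ge m_1\ge\cdots\ge m_r\ge 1$, $A_0$ a real symmetric positive definite $m_0\times m_0$ matrix, and $B_k$ a real $m_{k-1}\times m_k$ matrix of rank $m_k$ for $k=1,\dots,r$. Let $A$, $B$ be the associated $N\times N$ block matrices defined in the context and $\mathcal{L}=\frac12\mathrm{div}(AD)+\langle x,BD\rangle$ on $\mathbb{R}^N=\mathbb{R}^{m_0}\times\cdots\times\mathbb{R}^{m_r}$. If $u$ is a positive bounded solution of $\mathcal{L}u(x)=0$ on $\mathbb{R}^N$, then $u$ is constant.
   Context: $N=\sum_{k=0}^rm_k$. In block form (block sizes $m_0,\dots,m_r$), $A=\begin{pmatrix}A_0&0\\0&0\end{pmatrix}$ is the $N\times N$ matrix with upper left block $A_0$ and zeros elsewhere, and $B$ is the $N\times N$ matrix whose $(k,k+1)$ block is $B_k$ for $1\le k\le r$ and all of whose other blocks are zero. $D=(\partial_{x_1},\dots,\partial_{x_N})$ and $\langle\cdot,\cdot\rangle$ is the Euclidean inner product, so $\langle x,BDu\rangle=\sum_{i,j}x_iB_{ij}\partial_{x_j}u$, where $B_{ij}$ here denotes the scalar entries of $B$. *)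

theory Defs
  imports "HOL-Analysis.Analysis" "Jordan_Normal_Form.DL_Rank"
begin

text \<open>Matrices whose sizes depend on $r$ and the $m_k$ are of the type
  \<^typ>\<open>real mat\<close> of \<^theory>\<open>Jordan_Normal_Form.Matrix\<close>; the analysis
  takes place on the Euclidean space \<^typ>\<open>real ^ 'n\<close>. The symbols below are kept for
  the Euclidean space only.\<close>

no_notation vec_index (infixl "$" 100)
no_notation scalar_prod (infix "\<bullet>" 70)

definition pos_def_mat :: "real mat \<Rightarrow> bool" where
  "pos_def_mat M \<longleftrightarrow> square_mat M \<and>
     (\<forall>v \<in> carrier_vec (dim_row M). v \<noteq> 0\<^sub>v (dim_row M) \<longrightarrow> scalar_prod v (M *\<^sub>v v) > 0)"

text \<open>Blocks are numbered $0, \dots, r$, block $k$ consisting of the $m_k$ coordinates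
  starting at \<open>block_start m k\<close>.\<close>

definition block_start :: "(nat \<Rightarrow> nat) \<Rightarrow> nat \<Rightarrow> nat" where
  "block_start m k = (\<Sum>l<k. m l)"

definition total_dim :: "nat \<Rightarrow> (nat \<Rightarrow> nat) \<Rightarrow> nat" where
  "total_dim r m = (\<Sum>k\<le>r. m k)"

definition diffusion_mat :: "nat \<Rightarrow> (nat \<Rightarrow> nat) \<Rightarrow> real mat \<Rightarrow> real mat" where
  "diffusion_mat r m A0 =
     (let q = total_dim r m - m 0
      in four_block_mat A0 (0\<^sub>m (m 0) q) (0\<^sub>m q (m 0)) (0\<^sub>m q q))"

text \<open>With blocks numbered from $0$, the matrix $B_k$ sits in block row $k - 1$ and block
  column $k$. These positions are disjoint, so at most one summand is nonzero.\<close>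

definition drift_mat :: "nat \<Rightarrow> (nat \<Rightarrow> nat) \<Rightarrow> (nat \<Rightarrow> real mat) \<Rightarrow> real mat" where
  "drift_mat r m Bs = Matrix.mat (total_dim r m) (total_dim r m) (\<lambda>(i, j).
     \<Sum>k = 1..r.
       if i \<in> {block_start m (k - 1)..<block_start m k} \<and>
          j \<in> {block_start m k..<block_start m (Suc k)}
       then Bs k $$ (i - block_start m (k - 1), j - block_start m k) else 0)"

text \<open>\<open>idx\<close> numbers the coordinates of \<^typ>\<open>real ^ 'n\<close> by $0, \dots, N - 1$.\<close>

definition to_cart_mat :: "('n \<Rightarrow> nat) \<Rightarrow> real mat \<Rightarrow> real ^ 'n ^ 'n" where
  "to_cart_mat idx M = (\<chi> i j. M $$ (idx i, idx j))"

definition partial :: "'n \<Rightarrow> (real ^ 'n \<Rightarrow> real) \<Rightarrow> real ^ 'n \<Rightarrow> real" where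
  "partial i f x = deriv (\<lambda>t. f (x + t *\<^sub>R axis i 1)) 0"

definition C1_function :: "(real ^ 'n \<Rightarrow> real) \<Rightarrow> bool" where
  "C1_function f \<longleftrightarrow>
     (\<forall>i. (\<forall>x. (\<lambda>t. f (x + t *\<^sub>R axis i 1)) differentiable (at 0)) \<and>
          continuous_on UNIV (partial i f))"

definition C2_function :: "(real ^ 'n \<Rightarrow> real) \<Rightarrow> bool" where
  "C2_function f \<longleftrightarrow> C1_function f \<and> (\<forall>i. C1_function (partial i f))"

definition gradient :: "(real ^ 'n \<Rightarrow> real) \<Rightarrow> real ^ 'n \<Rightarrow> real ^ 'n" where
  "gradient f x = (\<chi> i. partial i f x)"

definition divergence :: "(real ^ 'n \<Rightarrow> real ^ 'n) \<Rightarrow> real ^ 'n \<Rightarrow> real" where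
  "divergence F x = (\<Sum>i\<in>UNIV. partial i (\<lambda>y. F y $ i) x)"

definition OU_operator ::
    "real ^ 'n ^ 'n \<Rightarrow> real ^ 'n ^ 'n \<Rightarrow> (real ^ 'n \<Rightarrow> real) \<Rightarrow> real ^ 'n \<Rightarrow> real" where
  "OU_operator A B u x =
     1 / 2 * divergence (\<lambda>y. A *v gradient u y) x + x \<bullet> (B *v gradient u x)"

end

theory Submission
  imports Defs
begin

text \<open>The proof is coupling by change of measure, turned into an application of the maximum
  principle. Let \<open>e = (B\<^sup>T)\<^sup>k A b\<close>. The ordinary differential equation \<open>z' = B\<^sup>T z - v A b\<close> with
  a scalar control \<open>v\<close> can be steered from \<open>z 0 = e\<close> to \<open>z T = 0\<close>. For \<open>\<bar>u\<bar> \<le> M\<close>, \<open>\<alpha> \<ge> 0\<close> and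
  a constant \<open>C\<close> above \<open>v\<^sup>2 \<langle>b, A b\<rangle>\<close> put
  \<open>H(t, x) = exp (-C (T - t)) (u(x + z t) + 2 \<alpha>)\<^sup>2 - 4 \<alpha> u(x)\<close>.
  The term \<open>B\<^sup>T z\<close> in the equation of \<open>z\<close> makes up for the difference of the drifts at
  \<open>x\<close> and \<open>x + z t\<close>, so that \<open>\<partial>\<^sub>t H + L H\<close> reduces to
  \<open>exp (-C (T - t)) (\<langle>A p, p\<rangle> - 2 f v \<langle>p, A b\<rangle> + C f\<^sup>2)\<close> with \<open>f = u(x + z t) + 2 \<alpha>\<close> and
  \<open>p = D u(x + z t)\<close>. This is nonnegative by the Cauchy-Schwarz inequality for \<open>A\<close>. Hence the
  bounded function \<open>H\<close> is everywhere at most its largest final value, which is at most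
  \<open>M\<^sup>2 + 4 \<alpha>\<^sup>2\<close> (\<open>backward_maximum_principle\<close>, \<open>OU_controlled_translation_estimate\<close>).

  Because \<open>B\<close> is nilpotent, a long time makes the steering cheap: rescaling one polynomial
  gives a control of size \<open>O(1/T)\<close>, so \<open>C T = O(1/T)\<close> (\<open>cheap_steering_path\<close>). Letting
  \<open>T \<rightarrow> \<infinity>\<close> leaves \<open>u(x + e)\<^sup>2 + 4 \<alpha> (u(x + e) - u(x)) \<le> M\<^sup>2\<close>, and \<open>\<alpha> \<rightarrow> \<infinity>\<close> gives
  \<open>u(x + e) \<le> u(x)\<close>; the opposite inequality comes from \<open>-b\<close>. So \<open>u\<close> is
  invariant under all translations by \<open>(B\<^sup>T)\<^sup>k A b\<close>. These vectors span the whole space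
  exactly when \<open>w = 0\<close> is the only vector with \<open>A B\<^sup>k w = 0\<close> for all \<open>k\<close>. The block structure
  ensures this: \<open>A y = 0\<close> means that block 0 of \<open>y\<close> vanishes, block 0 of \<open>B\<^sup>k w\<close> is
  \<open>B\<^sub>1 \<dots> B\<^sub>k w\<^sub>k\<close>, and every \<open>B\<^sub>k\<close> is injective because it has full column rank
  (\<open>drift_observable\<close>).\<close>

section \<open>Functions with continuous partial derivatives\<close>

lemma C1_function_line_derivative:
  assumes "C1_function f"
  shows "((\<lambda>t. f (y + t *\<^sub>R axis i 1)) has_real_derivative partial i f (y + t *\<^sub>R axis i 1)) (at t)"
proof -
  have "(\<lambda>s. f ((y + t *\<^sub>R axis i 1) + s *\<^sub>R axis i 1)) differentiable (at 0)"
    using assms by (simp add: C1_function_def)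
  then have "((\<lambda>s. f ((y + t *\<^sub>R axis i 1) + s *\<^sub>R axis i 1)) has_real_derivative
      partial i f (y + t *\<^sub>R axis i 1)) (at 0)"
    unfolding partial_def using DERIV_deriv_iff_real_differentiable by blast
  then have "((\<lambda>s. f (y + (s + t) *\<^sub>R axis i 1)) has_real_derivative
      partial i f (y + t *\<^sub>R axis i 1)) (at 0)"
    by (simp add: algebra_simps)
  then show ?thesis
    using DERIV_shift[of "\<lambda>t. f (y + t *\<^sub>R axis i 1)" _ 0 t] by simp
qed

text \<open>Change one coordinate at a time. The mean value theorem applied to each change produces a
  partial derivative at a nearby point, and continuity replaces it by the one at \<open>x\<close>, with
  an error controlled by the change of that coordinate.\<close>

lemma C1_function_has_derivative:
  fixes f :: "real ^ 'n \<Rightarrow> real"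
  assumes C1: "C1_function f"
  shows "(f has_derivative (\<lambda>h. gradient f x \<bullet> h)) (at x)"
proof -
  have main: "\<exists>d>0. \<forall>h. norm h < d \<longrightarrow>
      \<bar>f (x + h) - f x - gradient f x \<bullet> h\<bar> \<le> e * norm h" if "e > 0" for e
  proof -
    define e' where "e' = e / CARD('n)"
    have "e' > 0" using that by (simp add: e'_def)
    have "\<exists>d>0. \<forall>y. dist y x < d \<longrightarrow> \<bar>partial i f y - partial i f x\<bar> < e'" for i
    proof -
      have "isCont (partial i f) x"
        using C1 by (simp add: C1_function_def continuous_on_eq_continuous_at)
      then show ?thesis
        using \<open>e' > 0\<close> by (auto simp: continuous_at dist_real_def Lim_at
          dest!: spec[of _ e'] intro: exI) (metis dist_self abs_zero diff_self)
    qed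
    then obtain d where d: "\<And>i. d i > 0"
      "\<And>i y. dist y x < d i \<Longrightarrow> \<bar>partial i f y - partial i f x\<bar> < e'"
      by metis
    define d0 where "d0 = Min (range d)"
    have "d0 > 0" using d(1) by (simp add: d0_def)
    have close: "\<bar>partial i f y - partial i f x\<bar> < e'" if "dist y x < d0" for i y
    proof -
      have "d0 \<le> d i" unfolding d0_def by simp
      then show ?thesis using d(2)[of y i] that by simp
    qed
    have step: "\<bar>f (x + h) - f x - (\<Sum>i\<in>S. partial i f x * h $ i)\<bar> \<le> e' * (\<Sum>i\<in>S. \<bar>h $ i\<bar>)"
      if "finite S" "norm h < d0" "\<And>i. i \<notin> S \<Longrightarrow> h $ i = 0" for S :: "'n set" and h
      using that
    proof (induction S arbitrary: h rule: finite_induct)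
      case empty
      then have "h = 0" by (simp add: Finite_Cartesian_Product.vec_eq_iff)
      then show ?case by simp
    next
      case (insert p S)
      define k where "k = h - (h $ p) *\<^sub>R axis p 1"
      have k_p: "k $ p = 0" by (simp add: k_def)
      have k_i: "k $ i = h $ i" if "i \<noteq> p" for i
        using that by (simp add: k_def axis_def)
      have h_eq: "h = k + (h $ p) *\<^sub>R axis p 1" by (simp add: k_def)
      have small: "norm (k + t *\<^sub>R axis p 1) < d0" if "\<bar>t\<bar> \<le> \<bar>h $ p\<bar>" for t
      proof -
        have "norm (k + t *\<^sub>R axis p 1) \<le> norm h"
        proof (rule norm_le_componentwise_cart)
          fix i
          show "norm ((k + t *\<^sub>R axis p 1) $ i) \<le> norm (h $ i)"
            using that k_p k_i[of i] by (cases "i = p") (auto simp: axis_def)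
        qed
        then show ?thesis using insert.prems(1) by simp
      qed
      have IH: "\<bar>f (x + k) - f x - (\<Sum>i\<in>S. partial i f x * k $ i)\<bar> \<le> e' * (\<Sum>i\<in>S. \<bar>k $ i\<bar>)"
      proof (rule insert.IH)
        show "norm k < d0" using small[of 0] by simp
        show "k $ i = 0" if "i \<notin> S" for i
          using that k_p k_i[of i] insert.prems(2)[of i] by (cases "i = p") auto
      qed
      have on_S: "k $ i = h $ i" if "i \<in> S" for i
        using that insert.hyps(2) by (intro k_i) auto
      have eqs: "(\<Sum>i\<in>S. partial i f x * k $ i) = (\<Sum>i\<in>S. partial i f x * h $ i)"
        "(\<Sum>i\<in>S. \<bar>k $ i\<bar>) = (\<Sum>i\<in>S. \<bar>h $ i\<bar>)"
        using on_S by simp_all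
      have mvt: "\<exists>t. \<bar>t\<bar> \<le> \<bar>h $ p\<bar> \<and> f (x + h) - f (x + k)
          = h $ p * partial p f (x + k + t *\<^sub>R axis p 1)"
      proof -
        let ?g = "\<lambda>t. f (x + k + t *\<^sub>R axis p 1)"
        have der: "(?g has_real_derivative partial p f (x + k + t *\<^sub>R axis p 1)) (at t)" for t
          by (rule C1_function_line_derivative[OF C1])
        have end0: "?g (h $ p) = f (x + h)" "?g 0 = f (x + k)"
          by (simp_all add: k_def)
        consider "h $ p = 0" | "h $ p > 0" | "h $ p < 0" by linarith
        then show ?thesis
        proof cases
          case 1
          then show ?thesis using end0 by auto
        next
          case 2
          from MVT2[OF this, of ?g, OF der]
          obtain z where "0 < z" "z < h $ p"
            "?g (h $ p) - ?g 0 = (h $ p - 0) * partial p f (x + k + z *\<^sub>R axis p 1)" by blast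
          then show ?thesis using end0 by (intro exI[of _ z]) auto
        next
          case 3
          from MVT2[OF this, of ?g, OF der]
          obtain z where "h $ p < z" "z < 0"
            "?g 0 - ?g (h $ p) = (0 - h $ p) * partial p f (x + k + z *\<^sub>R axis p 1)" by blast
          then show ?thesis using end0 by (intro exI[of _ z]) (auto simp: algebra_simps)
        qed
      qed
      then obtain t where t: "\<bar>t\<bar> \<le> \<bar>h $ p\<bar>"
        "f (x + h) - f (x + k) = h $ p * partial p f (x + k + t *\<^sub>R axis p 1)" by blast
      have "\<bar>partial p f (x + k + t *\<^sub>R axis p 1) - partial p f x\<bar> < e'"
        by (rule close) (use small[OF t(1)] in \<open>simp add: dist_norm algebra_simps\<close>)
      then have "\<bar>h $ p\<bar> * \<bar>partial p f (x + k + t *\<^sub>R axis p 1) - partial p f x\<bar> \<le> \<bar>h $ p\<bar> * e'"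
        by (intro mult_left_mono) auto
      then have last: "\<bar>f (x + h) - f (x + k) - partial p f x * h $ p\<bar> \<le> e' * \<bar>h $ p\<bar>"
        unfolding t(2) by (simp add: abs_mult[symmetric] algebra_simps)
      have "\<bar>f (x + h) - f x - (\<Sum>i\<in>insert p S. partial i f x * h $ i)\<bar>
          \<le> \<bar>f (x + k) - f x - (\<Sum>i\<in>S. partial i f x * k $ i)\<bar>
            + \<bar>f (x + h) - f (x + k) - partial p f x * h $ p\<bar>"
        using insert.hyps eqs by simp
      also have "\<dots> \<le> e' * (\<Sum>i\<in>insert p S. \<bar>h $ i\<bar>)"
        using IH last eqs insert.hyps by (simp add: algebra_simps)
      finally show ?case .
    qed
    have "\<bar>f (x + h) - f x - gradient f x \<bullet> h\<bar> \<le> e * norm h" if "norm h < d0" for h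
    proof -
      have "\<bar>f (x + h) - f x - gradient f x \<bullet> h\<bar> \<le> e' * (\<Sum>i\<in>UNIV. \<bar>h $ i\<bar>)"
        using step[of UNIV h] that by (simp add: gradient_def inner_vec_def)
      also have "\<dots> \<le> e' * (\<Sum>i\<in>(UNIV :: 'n set). norm h)"
        using \<open>e' > 0\<close> by (intro mult_left_mono sum_mono component_le_norm_cart) auto
      also have "\<dots> = e * norm h" by (simp add: e'_def)
      finally show ?thesis .
    qed
    then show ?thesis using \<open>d0 > 0\<close> by blast
  qed
  show ?thesis
    unfolding has_derivative_at_alt
  proof (intro conjI allI impI)
    show "bounded_linear (\<lambda>h. gradient f x \<bullet> h)" by (rule bounded_linear_inner_right)
    fix e :: real assume "e > 0"
    then obtain d where "d > 0" and d: "\<And>h. norm h < d \<Longrightarrow>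
        \<bar>f (x + h) - f x - gradient f x \<bullet> h\<bar> \<le> e * norm h"
      using main by blast
    then show "\<exists>d>0. \<forall>y. norm (y - x) < d \<longrightarrow>
        norm (f y - f x - gradient f x \<bullet> (y - x)) \<le> e * norm (y - x)"
      by (intro exI[of _ d]) (use d[of "_ - x"] in auto)
  qed
qed

lemma C1_function_continuous: "C1_function f \<Longrightarrow> continuous_on UNIV f"
  by (meson C1_function_has_derivative continuous_at_imp_continuous_on has_derivative_continuous)

lemma C1_function_curve_derivative:
  assumes C1: "C1_function f" and g: "(g has_vector_derivative g') (at t)"
  shows "((\<lambda>t. f (g t)) has_real_derivative gradient f (g t) \<bullet> g') (at t)"
proof -
  have "((f \<circ> g) has_derivative ((\<lambda>h. gradient f (g t) \<bullet> h) \<circ> (\<lambda>s. s *\<^sub>R g'))) (at t)"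
    using g C1_function_has_derivative[OF C1]
    by (intro diff_chain_at) (simp_all add: has_vector_derivative_def)
  moreover have "(\<lambda>h. gradient f (g t) \<bullet> h) \<circ> (\<lambda>s. s *\<^sub>R g') = (*) (gradient f (g t) \<bullet> g')"
    by (auto simp: fun_eq_iff)
  ultimately show ?thesis
    by (simp add: has_field_derivative_def o_def)
qed

definition second_directional :: "(real ^ 'n \<Rightarrow> real) \<Rightarrow> real ^ 'n \<Rightarrow> real ^ 'n \<Rightarrow> real" where
  "second_directional u e x = (\<Sum>i\<in>UNIV. \<Sum>j\<in>UNIV. e $ i * e $ j * partial i (partial j u) x)"

lemma C2_function_second_directional:
  assumes C2: "C2_function u"
  shows "((\<lambda>s. gradient u (x + s *\<^sub>R e) \<bullet> e) has_real_derivative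
    second_directional u e (x + s *\<^sub>R e)) (at s)"
proof -
  have line: "((\<lambda>s. x + s *\<^sub>R e) has_vector_derivative e) (at s)"
    by (auto intro!: derivative_eq_intros)
  have "((\<lambda>s. partial j u (x + s *\<^sub>R e)) has_real_derivative
      gradient (partial j u) (x + s *\<^sub>R e) \<bullet> e) (at s)" for j
    using C2 C1_function_curve_derivative[OF _ line] by (simp add: C2_function_def)
  then have "((\<lambda>s. \<Sum>j\<in>UNIV. partial j u (x + s *\<^sub>R e) * e $ j) has_real_derivative
      (\<Sum>j\<in>UNIV. (gradient (partial j u) (x + s *\<^sub>R e) \<bullet> e) * e $ j)) (at s)"
    by (intro DERIV_sum DERIV_cmult_right)
  moreover have "(\<Sum>j\<in>UNIV. (gradient (partial j u) (x + s *\<^sub>R e) \<bullet> e) * e $ j)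
      = second_directional u e (x + s *\<^sub>R e)"
    unfolding second_directional_def
    by (subst sum.swap) (simp add: gradient_def inner_vec_def sum_distrib_right sum_distrib_left mult_ac)
  ultimately show ?thesis by (simp add: gradient_def inner_vec_def)
qed

lemma divergence_gradient:
  assumes C2: "C2_function u"
  shows "divergence (\<lambda>y. A *v gradient u y) x
    = (\<Sum>i\<in>UNIV. \<Sum>j\<in>UNIV. A $ i $ j * partial i (partial j u) x)"
proof -
  have "partial i (\<lambda>y. (A *v gradient u y) $ i) x = (\<Sum>j\<in>UNIV. A $ i $ j * partial i (partial j u) x)"
    for i
  proof -
    have "((\<lambda>t. partial j u (x + t *\<^sub>R axis i 1)) has_real_derivative
        partial i (partial j u) x) (at 0)" for j
      using C2 C1_function_line_derivative[of "partial j u" x i 0] by (simp add: C2_function_def)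
    then have "((\<lambda>t. \<Sum>j\<in>UNIV. A $ i $ j * partial j u (x + t *\<^sub>R axis i 1)) has_real_derivative
        (\<Sum>j\<in>UNIV. A $ i $ j * partial i (partial j u) x)) (at 0)"
      by (intro DERIV_sum DERIV_cmult)
    then show ?thesis
      by (subst partial_def) (auto simp: matrix_vector_mult_def gradient_def intro!: DERIV_imp_deriv)
  qed
  then show ?thesis by (simp add: divergence_def)
qed

section \<open>A maximum principle on a strip\<close>

text \<open>If \<open>D\<close> were positive, \<open>g\<close> would be positive just to the right of \<open>0\<close>, and \<open>f\<close> would
  increase there.\<close>

lemma max_second_derivative:
  fixes f g :: "real \<Rightarrow> real"
  assumes f: "\<And>s. (f has_real_derivative g s) (at s)"
    and g: "(g has_real_derivative D) (at 0)"
    and max: "\<And>s. f s \<le> f 0"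
  shows "g 0 = 0" and "D \<le> 0"
proof -
  show g0: "g 0 = 0"
    by (rule DERIV_local_max[OF f[of 0], of 1]) (use max in auto)
  show "D \<le> 0"
  proof (rule ccontr)
    assume "\<not> D \<le> 0"
    then obtain d where "d > 0" and d: "\<And>h. h > 0 \<Longrightarrow> h < d \<Longrightarrow> g 0 < g (0 + h)"
      using DERIV_pos_inc_right[OF g] by auto
    from MVT2[of 0 "d / 2" f g, OF _ f] \<open>d > 0\<close>
    obtain z where z: "0 < z" "z < d / 2" "f (d / 2) - f 0 = (d / 2 - 0) * g z" by auto
    have "g z > 0" using d[of z] z g0 by auto
    then have "f (d / 2) > f 0" using z \<open>d > 0\<close> by (smt (verit) mult_pos_pos)
    then show False using max[of "d / 2"] by simp
  qed
qed

text \<open>The inequality \<open>sub\<close> makes \<open>H\<close> a subsolution of the backward equation whose diffusion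
  matrix is the sum of \<open>e e\<^sup>T\<close> over the list \<open>L\<close>; in this form only derivatives along lines
  are needed. As the space is unbounded, a maximum is
  forced by subtracting a small multiple of the barrier \<open>\<phi>(t, x) = exp (- k t) (1 + \<bar>x\<bar>\<^sup>2)\<close>.
  Since the drift grows only linearly, \<open>\<phi>\<close> is a strict supersolution for large \<open>k\<close>, and the
  difference, a strict subsolution, has no maximum before the final time.\<close>

lemma backward_maximum_principle:
  fixes B :: "real ^ 'n ^ 'n" and L :: "(real ^ 'n) list" and H :: "real \<Rightarrow> real ^ 'n \<Rightarrow> real"
  assumes cont: "continuous_on ({0..T} \<times> UNIV) (\<lambda>(t, x). H t x)"
    and bdd: "\<And>t x. t \<in> {0..T} \<Longrightarrow> H t x \<le> K"
    and time: "\<And>t x. t \<in> {0..<T} \<Longrightarrow> ((\<lambda>s. H s x) has_real_derivative Ht t x) (at t)"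
    and space: "\<And>t x e s. t \<in> {0..<T} \<Longrightarrow>
      ((\<lambda>s. H t (x + s *\<^sub>R e)) has_real_derivative G t (x + s *\<^sub>R e) \<bullet> e) (at s)"
    and second: "\<And>t x e. t \<in> {0..<T} \<Longrightarrow>
      ((\<lambda>s. G t (x + s *\<^sub>R e) \<bullet> e) has_real_derivative S t x e) (at 0)"
    and sub: "\<And>t x. t \<in> {0..<T} \<Longrightarrow>
      0 \<le> Ht t x + 1 / 2 * (\<Sum>e\<leftarrow>L. S t x e) + x \<bullet> (B *v G t x)"
    and final: "\<And>x. H T x \<le> c"
    and t0: "t0 \<in> {0..T}"
  shows "H t0 x0 \<le> c"
proof (rule ccontr)
  assume "\<not> H t0 x0 \<le> c"
  then have gt: "H t0 x0 > c" by simp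
  define tr where "tr = (\<Sum>e\<leftarrow>L. e \<bullet> e)"
  obtain nb where nb: "nb > 0" "\<And>x. norm (B *v x) \<le> norm x * nb"
    using bounded_linear.pos_bounded[OF matrix_vector_mul_bounded_linear[of B]] by blast
  have Bx: "x \<bullet> (B *v x) \<le> nb * (x \<bullet> x)" for x
  proof -
    have "x \<bullet> (B *v x) \<le> norm x * norm (B *v x)" by (rule norm_cauchy_schwarz)
    also have "\<dots> \<le> norm x * (norm x * nb)" by (intro mult_left_mono nb) auto
    finally show ?thesis by (simp add: power2_norm_eq_inner[symmetric] power2_eq_square mult_ac)
  qed
  have "tr \<ge> 0" unfolding tr_def by (rule sum_list_nonneg) auto
  define k where "k = tr + 2 * nb + 1"
  have "k > 0" using \<open>tr \<ge> 0\<close> nb by (simp add: k_def)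
  have barrier: "tr + 2 * (x \<bullet> (B *v x)) < k * (1 + x \<bullet> x)" for x
  proof -
    have "0 \<le> (tr + 1) * (x \<bullet> x)" using \<open>tr \<ge> 0\<close> by simp
    then show ?thesis using Bx[of x] nb(1) by (simp add: k_def algebra_simps)
  qed
  define \<phi> where "\<phi> t x = exp (- k * t) * (1 + x \<bullet> x)" for t and x :: "real ^ 'n"
  have \<phi>_pos: "\<phi> t x > 0" for t x
    unfolding \<phi>_def by (intro mult_pos_pos add_pos_nonneg) auto
  \<comment> \<open>The penalised function still exceeds \<open>c\<close> at \<open>(t0, x0)\<close>, by half of the original excess.\<close>
  define \<delta> where "\<delta> = (H t0 x0 - c) / (2 * \<phi> t0 x0)"
  have "\<delta> > 0" using gt \<phi>_pos by (simp add: \<delta>_def)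
  define \<Psi> where "\<Psi> t x = H t x - \<delta> * \<phi> t x" for t x
  have start: "\<Psi> t0 x0 > c"
    using gt \<phi>_pos[of t0 x0] by (simp add: \<Psi>_def \<delta>_def field_simps)
  define R where "R = max (norm x0) (sqrt (\<bar>K - c\<bar> / (\<delta> * exp (- k * T))))"
  have far: "\<Psi> t x < c" if "t \<in> {0..T}" "norm x > R" for t x
  proof -
    have "\<bar>K - c\<bar> / (\<delta> * exp (- k * T)) \<le> R\<^sup>2"
    proof -
      have "\<bar>K - c\<bar> / (\<delta> * exp (- k * T)) = (sqrt (\<bar>K - c\<bar> / (\<delta> * exp (- k * T))))\<^sup>2"
        using \<open>\<delta> > 0\<close> by simp
      also have "\<dots> \<le> R\<^sup>2" unfolding R_def using \<open>\<delta> > 0\<close> by (intro power_mono) auto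
      finally show ?thesis .
    qed
    also have "R\<^sup>2 \<le> (norm x)\<^sup>2"
      using that(2) by (intro power_mono) (auto simp: R_def le_max_iff_disj)
    finally have "\<bar>K - c\<bar> \<le> \<delta> * (exp (- k * T) * (x \<bullet> x))"
      using \<open>\<delta> > 0\<close> by (simp add: field_simps power2_norm_eq_inner)
    also have "\<dots> < \<delta> * (exp (- k * T) * (1 + x \<bullet> x))"
      using \<open>\<delta> > 0\<close> by (simp add: algebra_simps)
    also have "\<dots> \<le> \<delta> * \<phi> t x"
      unfolding \<phi>_def using that(1) \<open>k > 0\<close> \<open>\<delta> > 0\<close>
      by (intro mult_left_mono mult_right_mono) auto
    finally show ?thesis using bdd[OF that(1), of x] by (simp add: \<Psi>_def)
  qed
  have "continuous_on ({0..T} \<times> cball 0 R) (\<lambda>p. \<Psi> (fst p) (snd p))"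
    unfolding \<Psi>_def \<phi>_def
    using continuous_on_subset[OF cont, of "{0..T} \<times> cball 0 R"]
    by (intro continuous_intros) (auto simp: case_prod_beta)
  moreover have "compact ({0..T} \<times> cball (0 :: real ^ 'n) R)"
    by (intro compact_Times) auto
  moreover have "(t0, x0) \<in> {0..T} \<times> cball 0 R" using t0 by (simp add: R_def)
  ultimately obtain p where p: "p \<in> {0..T} \<times> cball 0 R"
    "\<And>q. q \<in> {0..T} \<times> cball 0 R \<Longrightarrow> \<Psi> (fst q) (snd q) \<le> \<Psi> (fst p) (snd p)"
    using continuous_attains_sup[of "{0..T} \<times> cball 0 R" "\<lambda>p. \<Psi> (fst p) (snd p)"] by blast
  obtain t1 x1 where p_eq: "p = (t1, x1)" by (cases p)
  have t1: "t1 \<in> {0..T}" using p(1) p_eq by simp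
  have ball_max: "\<Psi> t x \<le> \<Psi> t1 x1" if "t \<in> {0..T}" "norm x \<le> R" for t x
    using p(2)[of "(t, x)"] that by (simp add: p_eq)
  have above: "\<Psi> t1 x1 > c"
    using ball_max[OF t0, of x0] start by (simp add: R_def)
  have glob_max: "\<Psi> t x \<le> \<Psi> t1 x1" if "t \<in> {0..T}" for t x
    using ball_max[OF that, of x] far[OF that, of x] above by fastforce
  have "\<Psi> T x1 < c"
    using final[of x1] mult_pos_pos[OF \<open>\<delta> > 0\<close> \<phi>_pos[of T x1]] unfolding \<Psi>_def by linarith
  then have "t1 \<noteq> T" using above by auto
  then have t1': "t1 \<in> {0..<T}" using t1 by auto
  define E where "E = \<delta> * exp (- k * t1)"
  have "E > 0" using \<open>\<delta> > 0\<close> by (simp add: E_def)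
  \<comment> \<open>As \<open>t1\<close> may be \<open>0\<close>, only later times can be compared; this yields an inequality.\<close>
  have time_le: "Ht t1 x1 + k * E * (1 + x1 \<bullet> x1) \<le> 0"
  proof (rule ccontr)
    assume "\<not> ?thesis"
    then have pos: "0 < Ht t1 x1 + k * E * (1 + x1 \<bullet> x1)" by simp
    have der: "((\<lambda>s. \<Psi> s x1) has_real_derivative Ht t1 x1 + k * E * (1 + x1 \<bullet> x1)) (at t1)"
      unfolding \<Psi>_def \<phi>_def E_def
      by (auto intro!: derivative_eq_intros time[OF t1'])
    obtain d where d: "d > 0" "\<And>h. h > 0 \<Longrightarrow> h < d \<Longrightarrow> \<Psi> t1 x1 < \<Psi> (t1 + h) x1"
      using DERIV_pos_inc_right[OF der pos] by blast
    define h where "h = min (d / 2) (T - t1)"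
    have "\<Psi> t1 x1 < \<Psi> (t1 + h) x1" using d t1' by (intro d(2)) (auto simp: h_def)
    moreover have "t1 + h \<in> {0..T}" using d t1' by (auto simp: h_def)
    ultimately show False using glob_max[of "t1 + h" x1] by simp
  qed
  have space_der: "((\<lambda>s. \<Psi> t1 (x1 + s *\<^sub>R e)) has_real_derivative
      G t1 (x1 + s *\<^sub>R e) \<bullet> e - 2 * E * ((x1 + s *\<^sub>R e) \<bullet> e)) (at s)" for e s
    unfolding \<Psi>_def \<phi>_def E_def
    by (auto intro!: derivative_eq_intros space[OF t1'] simp: inner_commute algebra_simps)
  have second_der: "((\<lambda>s. G t1 (x1 + s *\<^sub>R e) \<bullet> e - 2 * E * ((x1 + s *\<^sub>R e) \<bullet> e))
      has_real_derivative S t1 x1 e - 2 * E * (e \<bullet> e)) (at 0)" for e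
    using second[OF t1', of x1 e] by (auto intro!: derivative_eq_intros simp: inner_add_left)
  have max_line: "\<Psi> t1 (x1 + s *\<^sub>R e) \<le> \<Psi> t1 (x1 + 0 *\<^sub>R e)" for s e
    using glob_max[OF t1] by simp
  have "(G t1 x1 - (2 * E) *\<^sub>R x1) \<bullet> e = 0" for e
    using max_second_derivative(1)[OF space_der second_der max_line, of e]
    by (simp add: inner_diff_left)
  then have "G t1 x1 - (2 * E) *\<^sub>R x1 = 0"
    using inner_eq_zero_iff by blast
  then have grad: "G t1 x1 = (2 * E) *\<^sub>R x1" by simp
  have "S t1 x1 e \<le> 2 * E * (e \<bullet> e)" for e
    using max_second_derivative(2)[OF space_der second_der max_line, of e] by simp
  then have "(\<Sum>e\<leftarrow>L. S t1 x1 e) \<le> (\<Sum>e\<leftarrow>L. 2 * E * (e \<bullet> e))"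
    by (intro sum_list_mono)
  also have "\<dots> = 2 * E * tr" by (simp add: tr_def sum_list_const_mult)
  finally have "0 \<le> - k * E * (1 + x1 \<bullet> x1) + E * tr + 2 * E * (x1 \<bullet> (B *v x1))"
    using sub[OF t1', of x1] time_le grad by (simp add: matrix_vector_mult_scaleR)
  also have "\<dots> = - E * (k * (1 + x1 \<bullet> x1) - (tr + 2 * (x1 \<bullet> (B *v x1))))"
    by (simp add: algebra_simps)
  also have "\<dots> < 0" using barrier[of x1] \<open>E > 0\<close> by (simp add: mult_pos_pos)
  finally show False by simp
qed

section \<open>Decomposition of the diffusion matrix\<close>

text \<open>A Cholesky decomposition, by induction on a set of coordinates outside which the matrix
  vanishes: a positive diagonal entry is cleared by subtracting a rank one matrix, which is
  the Schur complement and stays positive semidefinite; a row with a zero diagonal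
  entry already vanishes.\<close>

lemma psd_sum_rank_one:
  fixes A :: "real ^ 'n ^ 'n"
  assumes sym: "transpose A = A" and psd: "\<And>x. 0 \<le> x \<bullet> (A *v x)"
  obtains L where "\<And>i j. A $ i $ j = (\<Sum>s\<leftarrow>L. s $ i * s $ j)"
proof -
  have "\<exists>L. \<forall>i j. A $ i $ j = (\<Sum>s\<leftarrow>L. s $ i * s $ j)"
    if "finite S" "\<And>i j. A $ i $ j = A $ j $ i" "\<And>x. 0 \<le> x \<bullet> (A *v x)"
      "\<And>i j. i \<notin> S \<Longrightarrow> A $ i $ j = 0" for S and A :: "real ^ 'n ^ 'n"
    using that
  proof (induction S arbitrary: A rule: finite_induct)
    case empty
    then show ?case by (intro exI[of _ "[]"]) auto
  next
    case (insert p S)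
    note sym = insert.prems(1) and psd = insert.prems(2)
    have quad: "(x + t *\<^sub>R axis p 1) \<bullet> (A *v (x + t *\<^sub>R axis p 1))
        = x \<bullet> (A *v x) + 2 * t * (A *v x) $ p + t\<^sup>2 * A $ p $ p" for x t
    proof -
      have "x \<bullet> (A *v axis p 1) = (\<Sum>i\<in>UNIV. x $ i * A $ p $ i)"
        by (simp add: matrix_vector_mult_basis column_def inner_vec_def sym[of _ p])
      also have "\<dots> = (A *v x) $ p" by (simp add: matrix_vector_mult_def mult.commute)
      finally have "x \<bullet> (A *v axis p 1) = (A *v x) $ p" .
      moreover have "axis p 1 \<bullet> (A *v y) = (A *v y) $ p" for y
        by (simp add: inner_axis')
      moreover have "(A *v axis p 1) $ p = A $ p $ p"
        by (simp add: matrix_vector_mult_basis column_def)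
      ultimately show ?thesis
        by (simp add: matrix_vector_right_distrib matrix_vector_mult_scaleR inner_add_left
            inner_add_right power2_eq_square algebra_simps)
    qed
    have app_nonneg: "A $ p $ p \<ge> 0" using psd[of "0 + 1 *\<^sub>R axis p 1"] quad[of 0 1] by simp
    show ?case
    proof (cases "A $ p $ p = 0")
      case True
      have "(A *v x) $ p = 0" for x
      proof (rule ccontr)
        define b where "b = (A *v x) $ p"
        assume "(A *v x) $ p \<noteq> 0"
        then have "b \<noteq> 0" by (simp add: b_def)
        \<comment> \<open>With a zero diagonal entry the form is affine in \<open>t\<close>; this \<open>t\<close> gives the value \<open>-1\<close>.\<close>
        define t where "t = - (x \<bullet> (A *v x) + 1) / (2 * b)"
        have "0 \<le> x \<bullet> (A *v x) + 2 * t * b"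
          using psd[of "x + t *\<^sub>R axis p 1"] quad[of x t] True by (simp add: b_def)
        also have "\<dots> = - 1" using \<open>b \<noteq> 0\<close> by (simp add: t_def field_simps)
        finally show False by simp
      qed
      then have "A $ p $ j = 0" for j
        by (metis column_def matrix_vector_mult_basis vec_lambda_beta)
      then have "A $ i $ j = 0" if "i \<notin> S" for i j
        using that insert.prems(3)[of i j] by (cases "i = p") auto
      then show ?thesis using insert.IH[of A] sym psd by blast
    next
      case False
      define a where "a = A $ p $ p"
      have "a > 0" using False app_nonneg by (simp add: a_def)
      define s :: "real ^ 'n" where "s = (\<chi> i. A $ p $ i / sqrt a)"
      have ss: "s $ i * s $ j = A $ p $ i * A $ p $ j / a" for i j
        using \<open>a > 0\<close> by (simp add: s_def)
      define A' :: "real ^ 'n ^ 'n" where "A' = (\<chi> i j. A $ i $ j - s $ i * s $ j)"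
      have A'x: "A' *v x = A *v x - (s \<bullet> x) *\<^sub>R s" for x
        by (simp add: A'_def matrix_vector_mult_def Finite_Cartesian_Product.vec_eq_iff
            inner_vec_def algebra_simps sum_subtractf sum_distrib_left)
      have sx: "s \<bullet> x = (A *v x) $ p / sqrt a" for x
        by (simp add: s_def inner_vec_def matrix_vector_mult_def sum_divide_distrib)
      have "0 \<le> x \<bullet> (A' *v x)" for x
      proof -
        \<comment> \<open>The minimiser of the quadratic function of \<open>t\<close> in \<open>quad\<close>.\<close>
        define t where "t = - (A *v x) $ p / a"
        have "0 \<le> x \<bullet> (A *v x) + 2 * t * (A *v x) $ p + t\<^sup>2 * a"
          using psd[of "x + t *\<^sub>R axis p 1"] quad[of x t] by (simp add: a_def)
        also have "\<dots> = x \<bullet> (A *v x) - ((A *v x) $ p)\<^sup>2 / a"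
          using \<open>a > 0\<close> by (simp add: t_def power2_eq_square field_simps)
        also have "\<dots> = x \<bullet> (A' *v x)"
          using \<open>a > 0\<close> by (simp add: A'x inner_diff_right inner_commute[of x s] sx power2_eq_square)
        finally show ?thesis .
      qed
      moreover have "A' $ i $ j = 0" if "i \<notin> S" for i j
      proof (cases "i = p")
        case True
        then show ?thesis using \<open>a > 0\<close> by (simp add: A'_def ss flip: a_def)
      next
        case False
        then have "A $ i $ k = 0" for k using that insert.prems(3)[of i k] by auto
        then show ?thesis using sym[of p i] by (simp add: A'_def ss)
      qed
      moreover have "A' $ i $ j = A' $ j $ i" for i j using sym by (simp add: A'_def)
      ultimately obtain L where L: "\<And>i j. A' $ i $ j = (\<Sum>s\<leftarrow>L. s $ i * s $ j)"
        using insert.IH[of A'] by blast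
      have "A $ i $ j = (\<Sum>s\<leftarrow>s # L. s $ i * s $ j)" for i j
        using L[of i j] by (simp add: A'_def)
      then show ?thesis by blast
    qed
  qed
  moreover have "A $ i $ j = A $ j $ i" for i j
    using sym by (simp add: transpose_def Finite_Cartesian_Product.vec_eq_iff)
  ultimately have "\<exists>L. \<forall>i j. A $ i $ j = (\<Sum>s\<leftarrow>L. s $ i * s $ j)"
    using psd by (meson UNIV_I finite_class.finite_UNIV)
  then show ?thesis using that by blast
qed

lemma sum_sum_list_swap:
  fixes f :: "'a \<Rightarrow> 'b \<Rightarrow> real"
  shows "(\<Sum>i\<in>I. \<Sum>s\<leftarrow>L. f i s) = (\<Sum>s\<leftarrow>L. \<Sum>i\<in>I. f i s)"
  by (induction L) (simp_all add: sum.distrib)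

lemma rank_one_sum_contract:
  fixes A :: "real ^ 'n ^ 'n"
  assumes A: "\<And>i j. A $ i $ j = (\<Sum>s\<leftarrow>L. s $ i * s $ j)"
  shows "(\<Sum>i\<in>UNIV. \<Sum>j\<in>UNIV. A $ i $ j * h i j) = (\<Sum>s\<leftarrow>L. \<Sum>i\<in>UNIV. \<Sum>j\<in>UNIV. s $ i * s $ j * h i j)"
  by (simp add: A sum_list_mult_const[symmetric] sum_sum_list_swap)

section \<open>The effect of a steered translation\<close>

text \<open>In probabilistic terms, \<open>x\<close> and \<open>x + z\<close> are the positions of two copies of the diffusion that
  meet at time \<open>T\<close> after a change of measure with density \<open>\<rho>\<close>, and
  \<open>exp (C T)\<close> bounds the second moment of \<open>\<rho>\<close>. The function \<open>H\<close> in the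
  proof comes from maximising
  \<open>\<rho> u(x + z t) - u(x) - \<alpha> (\<rho>\<^sup>2 exp (C (T - t)) - 2 \<rho> + 1)\<close> over \<open>\<rho>\<close>: for \<open>\<alpha> > 0\<close> the
  maximum is \<open>H(t, x) / (4 \<alpha>) - \<alpha>\<close>.\<close>

lemma OU_controlled_translation_estimate:
  fixes A B :: "real ^ 'n ^ 'n" and u :: "real ^ 'n \<Rightarrow> real"
  assumes sym: "transpose A = A" and psd: "\<And>x. 0 \<le> x \<bullet> (A *v x)"
    and C2: "C2_function u" and bdd: "\<And>x. \<bar>u x\<bar> \<le> M"
    and eq: "\<And>x. OU_operator A B u x = 0"
    and T: "T \<ge> 0" and \<alpha>: "\<alpha> \<ge> 0"
    and z: "\<And>t. (z has_vector_derivative (z t v* B - v t *\<^sub>R (A *v b))) (at t)"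
    and zT: "z T = 0"
    and v: "\<And>t. t \<in> {0..T} \<Longrightarrow> (v t)\<^sup>2 * (b \<bullet> (A *v b)) \<le> C"
  shows "exp (- C * T) * (u (x + z 0) + 2 * \<alpha>)\<^sup>2 \<le> 4 * \<alpha> * u x + M\<^sup>2 + 4 * \<alpha>\<^sup>2"
proof -
  obtain L where L: "\<And>i j. A $ i $ j = (\<Sum>s\<leftarrow>L. s $ i * s $ j)"
    using psd_sum_rank_one[OF sym psd] by blast
  have C1: "C1_function u" using C2 by (simp add: C2_function_def)
  have C0: "C \<ge> 0"
    using v[of 0] T mult_nonneg_nonneg[OF zero_le_power2[of "v 0"] psd[of b]] by simp
  have M0: "M \<ge> 0" using bdd[of 0] by linarith
  have Lpp: "(\<Sum>e\<leftarrow>L. (p \<bullet> e)\<^sup>2) = p \<bullet> (A *v p)" for p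
  proof -
    have "p \<bullet> (A *v p) = (\<Sum>i\<in>UNIV. \<Sum>j\<in>UNIV. A $ i $ j * (p $ i * p $ j))"
      by (simp add: inner_vec_def matrix_vector_mult_def sum_distrib_left mult_ac)
    also have "\<dots> = (\<Sum>e\<leftarrow>L. (p \<bullet> e)\<^sup>2)"
      unfolding rank_one_sum_contract[OF L] by (simp add: inner_vec_def power2_eq_square sum_product mult_ac)
    finally show ?thesis by simp
  qed
  have Lsd: "(\<Sum>e\<leftarrow>L. second_directional u e y) = - 2 * (y \<bullet> (B *v gradient u y))" for y
  proof -
    have "(\<Sum>e\<leftarrow>L. second_directional u e y) = divergence (\<lambda>y. A *v gradient u y) y"
      by (simp add: second_directional_def divergence_gradient[OF C2] rank_one_sum_contract[OF L])
    then show ?thesis using eq[of y] by (simp add: OU_operator_def)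
  qed
  define E where "E t = exp (- C * (T - t))" for t
  define H where "H t x = E t * (u (x + z t) + 2 * \<alpha>)\<^sup>2 - 4 * \<alpha> * u x" for t x
  define G where "G t x = (2 * E t * (u (x + z t) + 2 * \<alpha>)) *\<^sub>R gradient u (x + z t)
      - (4 * \<alpha>) *\<^sub>R gradient u x" for t x
  define Ht where "Ht t x = C * E t * (u (x + z t) + 2 * \<alpha>)\<^sup>2 + 2 * E t * (u (x + z t) + 2 * \<alpha>)
      * (gradient u (x + z t) \<bullet> (z t v* B - v t *\<^sub>R (A *v b)))" for t x
  define S where "S t x e = 2 * E t * ((gradient u (x + z t) \<bullet> e)\<^sup>2
      + (u (x + z t) + 2 * \<alpha>) * second_directional u e (x + z t))
      - 4 * \<alpha> * second_directional u e x" for t x e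
  have line: "((\<lambda>s. y + s *\<^sub>R e) has_vector_derivative e) (at s)" for y e :: "real ^ 'n" and s
    by (auto intro!: derivative_eq_intros)
  have u_line: "((\<lambda>s. u (y + s *\<^sub>R e)) has_real_derivative gradient u (y + s *\<^sub>R e) \<bullet> e) (at s)"
    for y e s by (rule C1_function_curve_derivative[OF C1 line])
  have u_shift: "((\<lambda>s. u (y + s *\<^sub>R e + w)) has_real_derivative gradient u (y + s *\<^sub>R e + w) \<bullet> e) (at s)"
    for y e w s using u_line[of "y + w" e s] by (simp add: algebra_simps)
  have g_line: "((\<lambda>s. gradient u (y + s *\<^sub>R e) \<bullet> e) has_real_derivative
      second_directional u e (y + s *\<^sub>R e)) (at s)" for y e s
    by (rule C2_function_second_directional[OF C2])
  have g_shift: "((\<lambda>s. gradient u (y + s *\<^sub>R e + w) \<bullet> e) has_real_derivative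
      second_directional u e (y + s *\<^sub>R e + w)) (at s)" for y e w s
    using g_line[of "y + w" e s] by (simp add: algebra_simps)
  have "H 0 x \<le> M\<^sup>2 + 4 * \<alpha>\<^sup>2"
  proof (rule backward_maximum_principle[where L = L and B = B and T = T and G = G and S = S
        and Ht = Ht and H = H and K = "(M + 2 * \<alpha>)\<^sup>2 + 4 * \<alpha> * M"])
    have "continuous_on UNIV z"
      by (intro continuous_at_imp_continuous_on ballI has_vector_derivative_continuous[OF z])
    then have zc: "continuous_on ({0..T} \<times> (UNIV :: (real ^ 'n) set)) (\<lambda>p. z (fst p))"
      by (rule continuous_on_compose2[OF _ continuous_on_fst[OF continuous_on_id]]) simp
    have uc: "continuous_on UNIV u" by (rule C1_function_continuous[OF C1])
    show "continuous_on ({0..T} \<times> UNIV) (\<lambda>(t, x). H t x)"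
      unfolding H_def E_def case_prod_beta
      by (intro continuous_intros continuous_on_compose2[OF uc] zc) auto
  next
    fix t x assume t: "t \<in> {0..T}"
    have "E t \<le> 1" using t C0 by (simp add: E_def)
    moreover have "(u (x + z t) + 2 * \<alpha>)\<^sup>2 \<le> (M + 2 * \<alpha>)\<^sup>2"
      using bdd[of "x + z t"] \<alpha> by (intro power2_le_iff_abs_le[THEN iffD2]) auto
    ultimately have "E t * (u (x + z t) + 2 * \<alpha>)\<^sup>2 \<le> 1 * (M + 2 * \<alpha>)\<^sup>2"
      by (intro mult_mono) auto
    moreover have "- (4 * \<alpha> * u x) \<le> 4 * \<alpha> * M"
      using mult_left_mono[of "- u x" M "4 * \<alpha>"] bdd[of x] \<alpha> by (simp add: abs_le_iff)
    ultimately show "H t x \<le> (M + 2 * \<alpha>)\<^sup>2 + 4 * \<alpha> * M" unfolding H_def by linarith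
  next
    fix t x
    have "((\<lambda>t. x + z t) has_vector_derivative (z t v* B - v t *\<^sub>R (A *v b))) (at t)"
      using z[of t] by (auto intro!: derivative_eq_intros)
    from C1_function_curve_derivative[OF C1 this]
    have u_z: "((\<lambda>s. u (x + z s)) has_real_derivative
      gradient u (x + z t) \<bullet> (z t v* B - v t *\<^sub>R (A *v b))) (at t)" .
    show "((\<lambda>s. H s x) has_real_derivative Ht t x) (at t)"
      unfolding H_def Ht_def E_def
      by (rule derivative_eq_intros u_z refl | simp add: algebra_simps)+
  next
    fix t x e s
    show "((\<lambda>s. H t (x + s *\<^sub>R e)) has_real_derivative G t (x + s *\<^sub>R e) \<bullet> e) (at s)"
      unfolding H_def G_def
      by (rule derivative_eq_intros u_line u_shift refl | simp add: inner_diff_left algebra_simps)+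
  next
    fix t x e
    have 1: "((\<lambda>s. u (x + s *\<^sub>R e + z t)) has_real_derivative gradient u (x + z t) \<bullet> e) (at 0)"
      and 2: "((\<lambda>s. gradient u (x + s *\<^sub>R e + z t) \<bullet> e) has_real_derivative
        second_directional u e (x + z t)) (at 0)"
      and 3: "((\<lambda>s. gradient u (x + s *\<^sub>R e) \<bullet> e) has_real_derivative
        second_directional u e x) (at 0)"
      using u_shift[of x e "z t" 0] g_shift[of x e "z t" 0] g_line[of x e 0] by simp_all
    show "((\<lambda>s. G t (x + s *\<^sub>R e) \<bullet> e) has_real_derivative S t x e) (at 0)"
      unfolding G_def S_def inner_diff_left inner_scaleR_left
      by (rule derivative_eq_intros 1 2 3 refl | simp add: power2_eq_square algebra_simps)+
  next
    fix t x assume t: "t \<in> {0..<T}"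
    define y where "y = x + z t"
    define f where "f = u y + 2 * \<alpha>"
    define p where "p = gradient u y"
    have E0: "E t > 0" by (simp add: E_def)
    have sumS: "(\<Sum>e\<leftarrow>L. S t x e) = 2 * E t * (p \<bullet> (A *v p) + f * (- 2 * (y \<bullet> (B *v p))))
        - 4 * \<alpha> * (- 2 * (x \<bullet> (B *v gradient u x)))"
      unfolding S_def Lpp[symmetric] Lsd[symmetric] p_def y_def[symmetric] f_def
      by (induction L) (simp_all add: algebra_simps)
    have pz: "p \<bullet> (z t v* B) = z t \<bullet> (B *v p)"
      by (simp add: inner_commute[of p] dot_lmul_matrix)
    have pA: "b \<bullet> (A *v p) = p \<bullet> (A *v b)"
      by (metis dot_lmul_matrix inner_commute sym vector_transpose_matrix)
    have "Ht t x + 1 / 2 * (\<Sum>e\<leftarrow>L. S t x e) + x \<bullet> (B *v G t x)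
        = E t * (C * f\<^sup>2 - 2 * f * v t * (p \<bullet> (A *v b)) + p \<bullet> (A *v p))"
      unfolding sumS Ht_def G_def y_def[symmetric] f_def[symmetric] p_def[symmetric]
        matrix_vector_mult_diff_distrib matrix_vector_mult_scaleR inner_diff_right pz
        inner_scaleR_right
      by (simp add: y_def inner_add_left algebra_simps)
    also have "\<dots> \<ge> 0"
    proof -
      have "0 \<le> (p - (f * v t) *\<^sub>R b) \<bullet> (A *v (p - (f * v t) *\<^sub>R b))" by (rule psd)
      also have "\<dots> = p \<bullet> (A *v p) - 2 * f * v t * (p \<bullet> (A *v b)) + f\<^sup>2 * ((v t)\<^sup>2 * (b \<bullet> (A *v b)))"
        by (simp add: matrix_vector_mult_diff_distrib matrix_vector_mult_scaleR inner_diff_left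
            inner_diff_right pA power2_eq_square algebra_simps)
      also have "\<dots> \<le> p \<bullet> (A *v p) - 2 * f * v t * (p \<bullet> (A *v b)) + f\<^sup>2 * C"
        using v[of t] t by (intro add_left_mono mult_left_mono) auto
      finally show ?thesis using E0 by (simp add: mult_ac)
    qed
    finally show "0 \<le> Ht t x + 1 / 2 * (\<Sum>e\<leftarrow>L. S t x e) + x \<bullet> (B *v G t x)" .
  next
    fix x
    have "(u x)\<^sup>2 \<le> M\<^sup>2" using bdd[of x] M0 by (simp add: abs_le_square_iff[symmetric])
    then show "H T x \<le> M\<^sup>2 + 4 * \<alpha>\<^sup>2"
      by (simp add: H_def E_def zT power2_eq_square algebra_simps)
  next
    show "0 \<in> {0..T}" using T by simp
  qed
  then show ?thesis by (simp add: H_def E_def)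
qed

section \<open>Steering at small cost\<close>

lemma poly_higher_pderiv_root:
  fixes P :: "real poly"
  assumes "[:- a, 1:] ^ n dvd P" "i < n"
  shows "poly ((pderiv ^^ i) P) a = 0"
  using assms
proof (induction i arbitrary: n P)
  case 0
  then have "[:- a, 1:] dvd P"
    by (metis dvd_power dvd_trans)
  then show ?case by (simp add: poly_eq_0_iff_dvd)
next
  case (Suc i)
  from Suc.prems(2) obtain m where m: "n = Suc m" by (cases n) auto
  from Suc.prems(1) obtain Q where "P = [:- a, 1:] ^ Suc m * Q" by (auto simp: m)
  then have "pderiv P = [:- a, 1:] ^ m *
      ([:- a, 1:] * pderiv Q + Polynomial.smult (of_nat (Suc m)) (Q * pderiv [:- a, 1:]))"
    by (simp only: pderiv_mult pderiv_power_Suc) (simp add: algebra_simps)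
  then have "[:- a, 1:] ^ m dvd pderiv P" by simp
  from Suc.IH[OF this] Suc.prems(2) show ?case by (simp add: m funpow_swap1)
qed

text \<open>The conditions at \<open>0\<close> and \<open>1\<close> are congruences modulo the coprime polynomials \<open>X\<^sup>n\<close> and
  \<open>(X - 1)\<^sup>n\<close> with \<open>n = r + 1\<close>. The polynomial \<open>K\<close> vanishes at \<open>0\<close> and is congruent to \<open>1\<close>
  modulo \<open>(X - 1)\<^sup>n\<close>. So \<open>E = 1 - K\<^sup>n\<close> is congruent to \<open>1\<close> modulo the first and to \<open>0\<close> modulo
  the second, and multiplying \<open>X\<^sup>p / p!\<close> by \<open>E\<close> gives a solution.\<close>

lemma exists_steering_polynomial:
  assumes "p \<le> r"
  obtains P :: "real poly"
  where "\<And>i. i \<le> r \<Longrightarrow> poly ((pderiv ^^ i) P) 0 = (if i = p then 1 else 0)"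
    and "\<And>i. i \<le> r \<Longrightarrow> poly ((pderiv ^^ i) P) 1 = 0"
proof -
  define n where "n = Suc r"
  define w :: "real poly" where "w = [:- 1, 1:] ^ n"
  define c :: real where "c = poly w 0"
  have c: "c \<noteq> 0" by (simp add: c_def w_def)
  define K where "K = 1 - Polynomial.smult (1 / c) w"
  define E where "E = 1 - K ^ n"
  have "poly K 0 = 0" using c by (simp add: K_def c_def)
  then have K0: "[:- 0, 1:] dvd K" by (simp add: poly_eq_0_iff_dvd)
  have "w dvd Polynomial.smult (1 / c) w" by (simp add: dvd_smult)
  also have "Polynomial.smult (1 / c) w = 1 - K" by (simp add: K_def)
  also have "1 - K dvd 1 - K ^ n"
    by (metis dvdI one_diff_power_eq)
  finally have E1: "w dvd E" by (simp add: E_def)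
  define Q :: "real poly" where "Q = monom (1 / fact p) p"
  define P where "P = E * Q"
  have P0: "[:- 0, 1:] ^ n dvd P - Q"
  proof -
    have "P - Q = - (K ^ n * Q)" by (simp add: P_def E_def algebra_simps)
    then show ?thesis using dvd_power_same[OF K0, of n] by (simp add: dvd_mult2)
  qed
  show ?thesis
  proof (rule that[of P])
    fix i assume i: "i \<le> r"
    have "poly ((pderiv ^^ i) (P - Q)) 0 = 0"
      by (rule poly_higher_pderiv_root[OF P0]) (use i in \<open>simp add: n_def\<close>)
    then have "poly ((pderiv ^^ i) P) 0 = poly ((pderiv ^^ i) Q) 0"
      using higher_pderiv_add[of i "P - Q" Q] by simp
    also have "\<dots> = (if i = p then 1 else 0)"
      by (simp add: poly_0_coeff_0 coeff_higher_pderiv Q_def pochhammer_fact[symmetric])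
    finally show "poly ((pderiv ^^ i) P) 0 = (if i = p then 1 else 0)" .
    have "[:- 1, 1:] ^ n dvd P" using E1 by (simp add: P_def w_def)
    then show "poly ((pderiv ^^ i) P) 1 = 0"
      by (rule poly_higher_pderiv_root) (use i in \<open>simp add: n_def\<close>)
  qed
qed

lemma linear_vector_matrix_mult: "linear (\<lambda>z. z v* B)" for B :: "real ^ 'n ^ 'n"
  using matrix_vector_mul_linear[of "transpose B"] by simp

text \<open>On the span of \<open>e 0, \<dots>, e r\<close> the controlled equation is a chain of integrators: with
  \<open>z t = (\<Sum>j\<le>r. f\<^sub>j(t) e j)\<close> it reads \<open>f\<^sub>j' = f\<^sub>j\<^sub>-\<^sub>1\<close> for \<open>j \<ge> 1\<close> and \<open>f\<^sub>0' = - v\<close>. So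
  all \<open>f\<^sub>j\<close> are derivatives of \<open>g = f\<^sub>r\<close>, whose derivatives up to order \<open>r\<close> at \<open>0\<close>
  and \<open>T\<close> are prescribed. Taking \<open>g(t) = T\<^sup>p P(t / T)\<close> with \<open>p = r - k\<close> makes the \<open>p\<close>-th
  derivative at \<open>0\<close> equal to \<open>1\<close> for every \<open>T\<close>, while the control is of order \<open>T\<^sup>p / T\<^bsup>r+1\<^esup> \<le> 1 / T\<close>
  for \<open>T \<ge> 1\<close>.\<close>

lemma cheap_steering_path:
  fixes e :: "nat \<Rightarrow> real ^ 'n" and B :: "real ^ 'n ^ 'n"
  assumes chain: "\<And>j. j \<le> r \<Longrightarrow> e j v* B = e (Suc j)" and nil: "e (Suc r) = 0" and k: "k \<le> r"
  obtains W where "W \<ge> 0"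
    and "\<And>T. T \<ge> 1 \<Longrightarrow> \<exists>z v. (\<forall>t. (z has_vector_derivative (z t v* B - v t *\<^sub>R e 0)) (at t)) \<and>
      z 0 = e k \<and> z T = 0 \<and> (\<forall>t\<in>{0..T}. \<bar>v t\<bar> \<le> W / T)"
proof -
  define p where "p = r - k"
  obtain P :: "real poly"
    where P0: "\<And>i. i \<le> r \<Longrightarrow> poly ((pderiv ^^ i) P) 0 = (if i = p then 1 else 0)"
      and P1: "\<And>i. i \<le> r \<Longrightarrow> poly ((pderiv ^^ i) P) 1 = 0"
    using exists_steering_polynomial[of p r] by (auto simp: p_def)
  have "continuous_on {0..1} (\<lambda>s. \<bar>poly ((pderiv ^^ Suc r) P) s\<bar>)"
    by (intro continuous_intros)
  then obtain s0 where "\<And>s. s \<in> {0..1} \<Longrightarrow>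
      \<bar>poly ((pderiv ^^ Suc r) P) s\<bar> \<le> \<bar>poly ((pderiv ^^ Suc r) P) s0\<bar>"
    using continuous_attains_sup[of "{0..1::real}"] by fastforce
  then obtain W where W: "W \<ge> 0" "\<And>s. s \<in> {0..1} \<Longrightarrow> \<bar>poly ((pderiv ^^ Suc r) P) s\<bar> \<le> W"
    by (meson abs_ge_zero)
  show ?thesis
  proof (rule that[OF W(1)])
    fix T :: real assume T: "T \<ge> 1"
    define F where "F i t = T ^ p / T ^ i * poly ((pderiv ^^ i) P) (t / T)" for i t
    have F': "((\<lambda>t. F i t) has_real_derivative F (Suc i) t) (at t)" for i t
      unfolding F_def using T
      by (auto intro!: derivative_eq_intros DERIV_chain'[OF _ poly_DERIV])
    define z where "z t = (\<Sum>j\<le>r. F (r - j) t *\<^sub>R e j)" for t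
    define v where "v t = - F (Suc r) t" for t
    have "(z has_vector_derivative (z t v* B - v t *\<^sub>R e 0)) (at t)" for t
    proof -
      have "(z has_vector_derivative (\<Sum>j\<le>r. F (Suc (r - j)) t *\<^sub>R e j)) (at t)"
        unfolding z_def
        by (intro has_vector_derivative_sum
            bounded_linear.has_vector_derivative[OF bounded_linear_scaleR_left]
            F'[unfolded has_real_derivative_iff_has_vector_derivative])
      also have "(\<Sum>j\<le>r. F (Suc (r - j)) t *\<^sub>R e j)
          = F (Suc r) t *\<^sub>R e 0 + (\<Sum>j<r. F (Suc (r - Suc j)) t *\<^sub>R e (Suc j))"
        by (subst sum.atMost_shift) simp
      also have "(\<Sum>j<r. F (Suc (r - Suc j)) t *\<^sub>R e (Suc j)) = (\<Sum>j<r. F (r - j) t *\<^sub>R e (Suc j))"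
        by (intro sum.cong) (auto simp: Suc_diff_Suc)
      also have "\<dots> = (\<Sum>j\<le>r. F (r - j) t *\<^sub>R e (Suc j))"
        using nil by (simp add: lessThan_Suc_atMost[symmetric])
      also have "\<dots> = (\<Sum>j\<le>r. (F (r - j) t *\<^sub>R e j) v* B)"
        using chain by (intro sum.cong) (simp_all add: linear_cmul[OF linear_vector_matrix_mult])
      also have "\<dots> = z t v* B"
        unfolding z_def by (simp add: linear_sum[OF linear_vector_matrix_mult])
      finally show ?thesis by (simp add: v_def add.commute)
    qed
    moreover have "z 0 = e k"
    proof -
      have "F (r - j) 0 = (if j = k then 1 else 0)" if "j \<le> r" for j
        using that T k P0[of "r - j"] by (auto simp: F_def p_def)
      then have "z 0 = (\<Sum>j\<le>r. (if j = k then 1 else 0) *\<^sub>R e j)"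
        unfolding z_def by (intro sum.cong) auto
      also have "\<dots> = e k" using k by (simp add: if_distrib[of "\<lambda>x. x *\<^sub>R _"] cong: if_cong)
      finally show ?thesis .
    qed
    moreover have "z T = 0"
      unfolding z_def F_def using T P1 by (intro sum.neutral) auto
    moreover have "\<bar>v t\<bar> \<le> W / T" if "t \<in> {0..T}" for t
    proof -
      have "t / T \<in> {0..1}" using that T by auto
      then have "T ^ p / T ^ Suc r * \<bar>poly ((pderiv ^^ Suc r) P) (t / T)\<bar> \<le> (1 / T) * W"
      proof (intro mult_mono W)
        have "T ^ p * T \<le> T ^ r * T" using T by (intro mult_right_mono power_increasing) (auto simp: p_def)
        then show "T ^ p / T ^ Suc r \<le> 1 / T" using T by (simp add: field_simps)
      qed (use T in auto)
      then show ?thesis using T by (simp add: v_def F_def abs_mult)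
    qed
    ultimately show "\<exists>z v. (\<forall>t. (z has_vector_derivative (z t v* B - v t *\<^sub>R e 0)) (at t)) \<and>
      z 0 = e k \<and> z T = 0 \<and> (\<forall>t\<in>{0..T}. \<bar>v t\<bar> \<le> W / T)" by blast
  qed
qed

section \<open>Liouville theorem for a nilpotent drift under the Kalman condition\<close>

abbreviation adjoint_orbit :: "real ^ 'n ^ 'n \<Rightarrow> nat \<Rightarrow> real ^ 'n \<Rightarrow> real ^ 'n" where
  "adjoint_orbit B k y \<equiv> ((\<lambda>z. z v* B) ^^ k) y"

text \<open>The bound \<open>\<bar>v\<bar> \<le> W / T\<close> allows \<open>C = \<beta> / T\<^sup>2\<close>, so the exponential factor tends to \<open>1\<close> as
  \<open>T \<rightarrow> \<infinity>\<close>. In the limit \<open>4 \<alpha>\<^sup>2\<close> cancels, the remaining inequality is linear in \<open>\<alpha>\<close>, and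
  \<open>\<alpha>\<close> is arbitrarily large.\<close>

lemma OU_bounded_solution_translation_le:
  fixes A B :: "real ^ 'n ^ 'n" and u :: "real ^ 'n \<Rightarrow> real"
  assumes sym: "transpose A = A" and psd: "\<And>x. 0 \<le> x \<bullet> (A *v x)"
    and nilp: "\<And>y. adjoint_orbit B (Suc r) y = 0"
    and C2: "C2_function u" and bdd: "bounded (range u)"
    and eq: "\<And>x. OU_operator A B u x = 0"
    and k: "k \<le> r"
  shows "u (x + adjoint_orbit B k (A *v b)) \<le> u x"
proof -
  obtain M where M: "\<And>x. \<bar>u x\<bar> \<le> M" using bdd by (auto simp: bounded_iff)
  define e where "e j = adjoint_orbit B j (A *v b)" for j
  have e0: "e 0 = A *v b" by (simp add: e_def)
  obtain W where W: "W \<ge> 0" and path: "\<And>T. T \<ge> 1 \<Longrightarrow>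
      \<exists>z v. (\<forall>t. (z has_vector_derivative (z t v* B - v t *\<^sub>R e 0)) (at t)) \<and>
      z 0 = e k \<and> z T = 0 \<and> (\<forall>t\<in>{0..T}. \<bar>v t\<bar> \<le> W / T)"
    using cheap_steering_path[of r e B k] nilp k by (auto simp: e_def)
  define \<beta> where "\<beta> = W\<^sup>2 * (b \<bullet> (A *v b))"
  have finite_T: "exp (- (\<beta> / T)) * (u (x + e k) + 2 * \<alpha>)\<^sup>2 \<le> 4 * \<alpha> * u x + M\<^sup>2 + 4 * \<alpha>\<^sup>2"
    if T: "T \<ge> 1" and \<alpha>: "\<alpha> \<ge> 0" for T \<alpha>
  proof -
    obtain z v where z: "\<And>t. (z has_vector_derivative (z t v* B - v t *\<^sub>R (A *v b))) (at t)"
      and z0: "z 0 = e k" and zT: "z T = 0" and v: "\<And>t. t \<in> {0..T} \<Longrightarrow> \<bar>v t\<bar> \<le> W / T"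
      using path[OF T] unfolding e0 by blast
    have "(v t)\<^sup>2 * (b \<bullet> (A *v b)) \<le> \<beta> / T\<^sup>2" if "t \<in> {0..T}" for t
    proof -
      have "(v t)\<^sup>2 \<le> (W / T)\<^sup>2" using v[OF that] by (metis abs_ge_zero power2_abs power_mono)
      then have "(v t)\<^sup>2 * (b \<bullet> (A *v b)) \<le> (W / T)\<^sup>2 * (b \<bullet> (A *v b))"
        by (intro mult_right_mono psd)
      then show ?thesis by (simp add: \<beta>_def power_divide)
    qed
    from OU_controlled_translation_estimate[OF sym psd C2 M eq _ \<alpha> z zT this, of x] T
    show ?thesis by (simp add: z0 power2_eq_square)
  qed
  have quad: "(u (x + e k) + 2 * \<alpha>)\<^sup>2 \<le> 4 * \<alpha> * u x + M\<^sup>2 + 4 * \<alpha>\<^sup>2" if \<alpha>: "\<alpha> \<ge> 0" for \<alpha>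
  proof (rule tendsto_upperbound)
    have "((\<lambda>T. \<beta> / T) \<longlongrightarrow> 0) at_top"
      by (intro tendsto_divide_0[OF tendsto_const] filterlim_at_top_imp_at_infinity filterlim_ident)
    then have "((\<lambda>T. exp (- (\<beta> / T)) * (u (x + e k) + 2 * \<alpha>)\<^sup>2)
        \<longlongrightarrow> exp (- 0) * (u (x + e k) + 2 * \<alpha>)\<^sup>2) at_top"
      by (intro tendsto_intros)
    then show "((\<lambda>T. exp (- (\<beta> / T)) * (u (x + e k) + 2 * \<alpha>)\<^sup>2) \<longlongrightarrow> (u (x + e k) + 2 * \<alpha>)\<^sup>2) at_top"
      by simp
    show "\<forall>\<^sub>F T in at_top. exp (- (\<beta> / T)) * (u (x + e k) + 2 * \<alpha>)\<^sup>2 \<le> 4 * \<alpha> * u x + M\<^sup>2 + 4 * \<alpha>\<^sup>2"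
      using finite_T[OF _ \<alpha>] by (intro eventually_at_top_linorderI[of 1])
  qed simp
  have "u (x + e k) \<le> u x"
  proof (rule ccontr)
    define d where "d = u (x + e k) - u x"
    assume "\<not> u (x + e k) \<le> u x"
    then have d: "d > 0" by (simp add: d_def)
    \<comment> \<open>Chosen such that \<open>4 \<alpha> d\<close> exceeds \<open>M\<^sup>2\<close>.\<close>
    define \<alpha> where "\<alpha> = (M\<^sup>2 + 1) / (4 * d)"
    have "\<alpha> \<ge> 0" using d by (simp add: \<alpha>_def)
    from quad[OF this] have "(u (x + e k))\<^sup>2 + 4 * \<alpha> * d \<le> M\<^sup>2"
      by (simp add: d_def power2_eq_square algebra_simps)
    moreover have "4 * \<alpha> * d = M\<^sup>2 + 1" using d by (simp add: \<alpha>_def)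
    ultimately show False using zero_le_power2[of "u (x + e k)"] by linarith
  qed
  then show ?thesis by (simp add: e_def)
qed

lemma linear_adjoint_orbit: "linear (adjoint_orbit B k)" for B :: "real ^ 'n ^ 'n"
proof (induction k)
  case 0
  then show ?case by (simp add: linear_id[unfolded id_def] id_def)
next
  case (Suc k)
  from linear_compose[OF Suc linear_vector_matrix_mult] show ?case by (simp add: o_def)
qed

lemma inner_adjoint_orbit: "w \<bullet> adjoint_orbit B k y = ((*v) B ^^ k) w \<bullet> y"
  for B :: "real ^ 'n ^ 'n"
proof (induction k arbitrary: w)
  case (Suc k)
  have "w \<bullet> adjoint_orbit B (Suc k) y = (B *v w) \<bullet> adjoint_orbit B k y"
    by (simp add: inner_commute[of w] dot_lmul_matrix) (simp add: inner_commute)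
  then show ?case by (simp add: Suc funpow_swap1)
qed simp

text \<open>The vectors by which \<open>u\<close> may be translated span the space, since by \<open>kalman\<close> no nonzero
  vector is orthogonal to all of them.\<close>

lemma OU_nilpotent_Liouville:
  fixes A B :: "real ^ 'n ^ 'n" and u :: "real ^ 'n \<Rightarrow> real"
  assumes sym: "transpose A = A" and psd: "\<And>x. 0 \<le> x \<bullet> (A *v x)"
    and nilp: "\<And>y. ((*v) B ^^ Suc r) y = 0"
    and kalman: "\<And>w. (\<And>k. k \<le> r \<Longrightarrow> A *v ((*v) B ^^ k) w = 0) \<Longrightarrow> w = 0"
    and C2: "C2_function u" and bdd: "bounded (range u)"
    and eq: "\<And>x. OU_operator A B u x = 0"
  shows "u constant_on UNIV"
proof -
  have nilp': "adjoint_orbit B (Suc r) y = 0" for y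
    using inner_adjoint_orbit[where w = "adjoint_orbit B (Suc r) y" and B = B and k = "Suc r" and y = y] nilp
    by (metis inner_eq_zero_iff inner_zero_left)
  define S where "S = {adjoint_orbit B k (A *v b) | k b. k \<le> r}"
  have inv: "u (x + adjoint_orbit B k (A *v b)) = u x" if "k \<le> r" for x k b
  proof (rule antisym)
    note le = OU_bounded_solution_translation_le[OF sym psd nilp' C2 bdd eq that]
    show "u (x + adjoint_orbit B k (A *v b)) \<le> u x" by (rule le)
    have "adjoint_orbit B k (A *v (- b)) = - adjoint_orbit B k (A *v b)"
      using linear_neg[OF linear_adjoint_orbit] linear_neg[OF matrix_vector_mul_linear] by metis
    then show "u x \<le> u (x + adjoint_orbit B k (A *v b))"
      using le[of "x + adjoint_orbit B k (A *v b)" "- b"] by simp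
  qed
  have "span S = UNIV"
  proof (rule ccontr)
    assume "span S \<noteq> UNIV"
    then obtain w where "w \<noteq> 0" and w: "\<And>y. y \<in> span S \<Longrightarrow> w \<bullet> y = 0"
      using orthogonal_to_subspace_exists_gen[of S UNIV] unfolding Linear_Algebra.orthogonal_def
      by (metis psubsetI span_UNIV top_greatest)
    have "A *v ((*v) B ^^ k) w = 0" if "k \<le> r" for k
    proof -
      define q where "q = A *v ((*v) B ^^ k) w"
      have "w \<bullet> adjoint_orbit B k (A *v q) = 0"
        using that by (intro w span_base) (auto simp: S_def)
      then have "((*v) B ^^ k) w \<bullet> (A *v q) = 0"
        by (simp add: inner_adjoint_orbit)
      then have "q \<bullet> q = 0"
        by (metis dot_lmul_matrix q_def sym vector_transpose_matrix)
      then show ?thesis by (simp add: q_def)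
    qed
    then show False using kalman \<open>w \<noteq> 0\<close> by blast
  qed
  have "u (x + h) = u x" if "h \<in> span S" for x h
    using that
  proof (induction h arbitrary: x rule: span_induct_alt)
    case (step c y h)
    then obtain k b where kb: "k \<le> r" "y = adjoint_orbit B k (A *v b)" by (auto simp: S_def)
    have "c *\<^sub>R y = adjoint_orbit B k (A *v (c *\<^sub>R b))"
      by (simp add: kb linear_cmul[OF linear_adjoint_orbit] matrix_vector_mult_scaleR)
    then have "u (x + h + c *\<^sub>R y) = u (x + h)" using inv[OF kb(1)] by metis
    then show ?case using step.IH[of x] by (simp add: add_ac)
  qed simp
  then have "u h = u 0" for h
    using \<open>span S = UNIV\<close> by (metis UNIV_I add_0)
  then show ?thesis by (auto simp: constant_on_def)
qed

section \<open>The block matrices\<close>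

text \<open>Two equal columns would make the number of distinct columns, and hence the rank, smaller
  than \<open>nc\<close>; so the columns are distinct and linearly independent.\<close>

lemma full_column_rank_kernel:
  fixes M :: "real mat"
  assumes M: "M \<in> carrier_mat n nc" and rank: "vec_space.rank n M = nc"
    and v: "v \<in> carrier_vec nc" and Mv: "M *\<^sub>v v = 0\<^sub>v n"
  shows "v = 0\<^sub>v nc"
proof -
  interpret vec_space "TYPE(real)" n .
  obtain S where S: "maximal S (\<lambda>T. T \<subseteq> set (cols M) \<and> lin_indpt T)"
    using maximal_exists[of "(\<lambda>T. T \<subseteq> set (cols M) \<and> lin_indpt T)" "card (set (cols M))" "{}"]
    by (meson List.finite_set card_mono empty_iff empty_subsetI finite_lin_indpt2 rev_finite_subset)
  have "nc = card S" using rank_card_indpt[OF M S] rank by simp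
  also have "\<dots> \<le> card (set (cols M))" using S by (simp add: card_mono maximal_def)
  finally have "length (cols M) \<le> card (set (cols M))" using M by simp
  then have "distinct (cols M)" using card_length[of "cols M"] by (intro card_distinct) simp
  then show ?thesis
    using full_rank_lin_indpt[OF M rank] lin_depI[OF M v _ Mv] by blast
qed

lemma mult_mat_vec_of_fun:
  fixes M :: "real mat"
  assumes "M \<in> carrier_mat nr nc"
  shows "M *\<^sub>v Matrix.vec nc f = Matrix.vec nr (\<lambda>a. \<Sum>b<nc. M $$ (a, b) * f b)"
  using assms by (intro eq_vecI) (auto simp: scalar_prod_def atLeast0LessThan intro!: sum.cong)

lemma block_start_mono: "i \<le> j \<Longrightarrow> block_start m i \<le> block_start m j"
  unfolding block_start_def by (intro sum_mono2) auto

lemma block_start_Suc: "block_start m (Suc k) = block_start m k + m k"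
  by (simp add: block_start_def)

lemma total_dim_block_start: "total_dim r m = block_start m (Suc r)"
  by (simp add: total_dim_def block_start_def lessThan_Suc_atMost)

lemma index_in_some_block:
  assumes "a < block_start m (Suc n)"
  shows "\<exists>j\<le>n. block_start m j \<le> a \<and> a < block_start m (Suc j)"
  using assms
proof (induction n)
  case 0
  then show ?case by (auto simp: block_start_def)
next
  case (Suc n)
  then show ?case by (cases "a < block_start m (Suc n)") (auto simp: not_less intro: le_SucI)
qed

lemma drift_mat_entry:
  assumes a: "block_start m j \<le> a" "a < block_start m (Suc j)" and j: "j < r"
    and b: "b < total_dim r m"
  shows "drift_mat r m Bs $$ (a, b) =
    (if block_start m (Suc j) \<le> b \<and> b < block_start m (Suc (Suc j))
     then Bs (Suc j) $$ (a - block_start m j, b - block_start m (Suc j)) else 0)"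
proof -
  have a_N: "a < total_dim r m"
    using a(2) block_start_mono[of "Suc j" "Suc r" m] j by (simp add: total_dim_block_start)
  have only: "k = Suc j" if "k \<ge> 1" "block_start m (k - 1) \<le> a" "a < block_start m k" for k
  proof (rule ccontr)
    assume "k \<noteq> Suc j"
    then consider "k \<le> j" | "Suc j \<le> k - 1" using that(1) by linarith
    then show False
      using block_start_mono[of k j m] block_start_mono[of "Suc j" "k - 1" m] a that by cases auto
  qed
  have "drift_mat r m Bs $$ (a, b) = (\<Sum>k = 1..r.
      if a \<in> {block_start m (k - 1)..<block_start m k} \<and>
         b \<in> {block_start m k..<block_start m (Suc k)}
      then Bs k $$ (a - block_start m (k - 1), b - block_start m k) else 0)"
    unfolding drift_mat_def using a_N b by simp
  also have "\<dots> = (\<Sum>k = 1..r. if k = Suc j then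
     (if block_start m (Suc j) \<le> b \<and> b < block_start m (Suc (Suc j))
      then Bs (Suc j) $$ (a - block_start m j, b - block_start m (Suc j)) else 0) else 0)"
  proof (rule sum.cong[OF refl])
    fix k assume "k \<in> {1..r}"
    then have "a \<in> {block_start m (k - 1)..<block_start m k} \<longleftrightarrow> k = Suc j"
      using only[of k] a by auto
    then show "(if a \<in> {block_start m (k - 1)..<block_start m k} \<and>
         b \<in> {block_start m k..<block_start m (Suc k)}
       then Bs k $$ (a - block_start m (k - 1), b - block_start m k) else 0)
      = (if k = Suc j then
         (if block_start m (Suc j) \<le> b \<and> b < block_start m (Suc (Suc j))
          then Bs (Suc j) $$ (a - block_start m j, b - block_start m (Suc j)) else 0) else 0)"
      by simp
  qed
  finally show ?thesis using j by simp
qed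

lemma drift_mat_last_rows:
  assumes "block_start m r \<le> a" "a < total_dim r m" "b < total_dim r m"
  shows "drift_mat r m Bs $$ (a, b) = 0"
proof -
  have "\<not> a < block_start m k" if "k \<le> r" for k
    using block_start_mono[OF that, of m] assms(1) by simp
  then show ?thesis using assms by (auto simp: drift_mat_def intro!: sum.neutral)
qed

lemma diffusion_mat_entry:
  assumes "A0 \<in> carrier_mat (m 0) (m 0)" "a < total_dim r m" "b < total_dim r m"
  shows "diffusion_mat r m A0 $$ (a, b) = (if a < m 0 \<and> b < m 0 then A0 $$ (a, b) else 0)"
proof -
  have "m 0 \<le> total_dim r m" unfolding total_dim_def by (rule member_le_sum) auto
  then show ?thesis using assms by (simp add: diffusion_mat_def Let_def)
qed

locale block_coordinates =
  fixes r :: nat and m :: "nat \<Rightarrow> nat" and idx :: "'n::finite \<Rightarrow> nat"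
  assumes idx_bij: "bij_betw idx UNIV {..<total_dim r m}"
begin

definition coord :: "real ^ 'n \<Rightarrow> nat \<Rightarrow> real" where
  "coord x a = x $ inv_into UNIV idx a"

lemma coord_idx: "coord x (idx i) = x $ i"
  using idx_bij by (simp add: coord_def bij_betw_def inv_f_f)

lemma idx_less: "idx i < total_dim r m"
  using idx_bij by (auto simp: bij_betw_def)

lemma idx_surj: "a < total_dim r m \<Longrightarrow> \<exists>i. idx i = a"
  by (metis idx_bij bij_betw_def imageE lessThan_iff)

lemma sum_over_interval:
  fixes g :: "nat \<Rightarrow> real"
  assumes "lo + c \<le> total_dim r m"
  shows "(\<Sum>i\<in>UNIV. if lo \<le> idx i \<and> idx i < lo + c then g (idx i) else 0) = (\<Sum>a<c. g (lo + a))"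
proof -
  have "(\<Sum>i\<in>UNIV. if lo \<le> idx i \<and> idx i < lo + c then g (idx i) else 0)
      = (\<Sum>a<total_dim r m. if lo \<le> a \<and> a < lo + c then g a else 0)"
    using sum.reindex_bij_betw[OF idx_bij, of "\<lambda>a. if lo \<le> a \<and> a < lo + c then g a else 0"] .
  also have "\<dots> = (\<Sum>a\<in>{lo..<lo + c}. g a)"
    using assms by (intro sum.mono_neutral_cong_right) auto
  also have "\<dots> = (\<Sum>a<c. g (lo + a))"
    by (rule sum.reindex_bij_witness[of _ "\<lambda>a. lo + a" "\<lambda>a. a - lo"]) auto
  finally show ?thesis .
qed

definition block_vec :: "nat \<Rightarrow> real ^ 'n \<Rightarrow> real Matrix.vec" where
  "block_vec j x = Matrix.vec (m j) (\<lambda>a. coord x (block_start m j + a))"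

lemma block_vec_carrier: "block_vec j x \<in> carrier_vec (m j)"
  by (simp add: block_vec_def)

lemma all_block_vecs_zero:
  assumes "\<And>j. j \<le> r \<Longrightarrow> block_vec j x = 0\<^sub>v (m j)"
  shows "x = 0"
proof -
  have "x $ i = 0" for i
  proof -
    obtain j where j: "j \<le> r" "block_start m j \<le> idx i" "idx i < block_start m (Suc j)"
      using index_in_some_block idx_less[of i] unfolding total_dim_block_start by blast
    then have "vec_index (block_vec j x) (idx i - block_start m j) = x $ i"
      by (simp add: block_vec_def block_start_Suc coord_idx less_diff_conv2)
    moreover have "vec_index (block_vec j x) (idx i - block_start m j) = 0"
      using assms[OF j(1)] j by (simp add: block_start_Suc less_diff_conv2)
    ultimately show ?thesis by simp
  qed
  then show ?thesis by (simp add: Finite_Cartesian_Product.vec_eq_iff)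
qed

lemma block_end_le: "j \<le> r \<Longrightarrow> block_start m j + m j \<le> total_dim r m"
  unfolding total_dim_block_start block_start_Suc[symmetric] by (intro block_start_mono) simp

lemma coord_drift:
  assumes "j < r" "a < m j"
  shows "coord (to_cart_mat idx (drift_mat r m Bs) *v x) (block_start m j + a)
    = (\<Sum>b<m (Suc j). Bs (Suc j) $$ (a, b) * coord x (block_start m (Suc j) + b))"
proof -
  obtain i where i: "idx i = block_start m j + a"
    using idx_surj block_end_le[of j] assms by (metis add_strict_left_mono less_imp_le order_less_le_trans)
  have "coord (to_cart_mat idx (drift_mat r m Bs) *v x) (block_start m j + a)
      = (to_cart_mat idx (drift_mat r m Bs) *v x) $ i"
    by (simp flip: i add: coord_idx)
  also have "\<dots> = (\<Sum>l\<in>UNIV. drift_mat r m Bs $$ (block_start m j + a, idx l) * x $ l)"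
    by (simp add: matrix_vector_mult_def to_cart_mat_def i)
  also have "\<dots> = (\<Sum>l\<in>UNIV. if block_start m (Suc j) \<le> idx l \<and>
        idx l < block_start m (Suc j) + m (Suc j)
      then Bs (Suc j) $$ (a, idx l - block_start m (Suc j)) * coord x (idx l) else 0)"
    by (intro sum.cong) (use assms in \<open>auto simp: drift_mat_entry[OF _ _ assms(1) idx_less]
        block_start_Suc coord_idx\<close>)
  also have "\<dots> = (\<Sum>b<m (Suc j). Bs (Suc j) $$ (a, b) * coord x (block_start m (Suc j) + b))"
    by (subst sum_over_interval) (use assms block_end_le[of "Suc j"] in auto)
  finally show ?thesis .
qed

lemma block_vec_drift:
  assumes "j < r" "Bs (Suc j) \<in> carrier_mat (m j) (m (Suc j))"
  shows "block_vec j (to_cart_mat idx (drift_mat r m Bs) *v x) = Bs (Suc j) *\<^sub>v block_vec (Suc j) x"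
  using assms(1) by (auto simp: block_vec_def mult_mat_vec_of_fun[OF assms(2)] coord_drift)

lemma block_vec_drift_last:
  "block_vec r (to_cart_mat idx (drift_mat r m Bs) *v x) = 0\<^sub>v (m r)"
proof (rule eq_vecI)
  fix a assume "a < dim_vec (0\<^sub>v (m r) :: real Matrix.vec)"
  then have a: "a < m r" by simp
  then obtain i where i: "idx i = block_start m r + a"
    using idx_surj block_end_le[of r] by (metis add_strict_left_mono order.refl order_less_le_trans)
  have "vec_index (block_vec r (to_cart_mat idx (drift_mat r m Bs) *v x)) a
      = (to_cart_mat idx (drift_mat r m Bs) *v x) $ i"
    using a by (simp add: block_vec_def flip: i coord_idx)
  also have "\<dots> = 0"
    using idx_less[of i] by (simp add: matrix_vector_mult_def to_cart_mat_def i drift_mat_last_rows idx_less)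
  finally show "vec_index (block_vec r (to_cart_mat idx (drift_mat r m Bs) *v x)) a
      = vec_index (0\<^sub>v (m r)) a" using a by simp
qed (simp add: block_vec_def)

lemma diffusion_quadratic_form:
  assumes A0: "A0 \<in> carrier_mat (m 0) (m 0)"
  shows "x \<bullet> (to_cart_mat idx (diffusion_mat r m A0) *v x)
    = scalar_prod (block_vec 0 x) (A0 *\<^sub>v block_vec 0 x)"
proof -
  have le: "0 + m 0 \<le> total_dim r m" using block_end_le[of 0] by (simp add: block_start_def)
  have "x \<bullet> (to_cart_mat idx (diffusion_mat r m A0) *v x)
    = (\<Sum>i\<in>UNIV. \<Sum>l\<in>UNIV. x $ i * (diffusion_mat r m A0 $$ (idx i, idx l) * x $ l))"
    by (simp add: inner_vec_def matrix_vector_mult_def to_cart_mat_def sum_distrib_left)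
  also have "\<dots> = (\<Sum>i\<in>UNIV. if 0 \<le> idx i \<and> idx i < 0 + m 0 then (\<Sum>l\<in>UNIV.
      if 0 \<le> idx l \<and> idx l < 0 + m 0 then coord x (idx i) * (A0 $$ (idx i, idx l) * coord x (idx l)) else 0) else 0)"
    by (intro sum.cong) (auto simp: diffusion_mat_entry[OF A0 idx_less idx_less] coord_idx
        intro!: sum.cong sum.neutral)
  also have "\<dots> = (\<Sum>a<m 0. \<Sum>b<m 0. coord x a * (A0 $$ (a, b) * coord x b))"
    by (simp only: sum_over_interval[OF le, of "\<lambda>c. coord x (idx _) * (A0 $$ (idx _, c) * coord x c)"]
        sum_over_interval[OF le, of "\<lambda>a. \<Sum>b<m 0. coord x a * (A0 $$ (a, 0 + b) * coord x (0 + b))"]) simp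
  also have "\<dots> = scalar_prod (block_vec 0 x) (A0 *\<^sub>v block_vec 0 x)"
    by (simp add: block_vec_def mult_mat_vec_of_fun[OF A0] scalar_prod_def atLeast0LessThan
        block_start_def sum_distrib_left)
  finally show ?thesis .
qed

text \<open>Block \<open>j\<close> of \<open>B x\<close> depends only on block \<open>j + 1\<close> of \<open>x\<close>, and block \<open>r\<close> of \<open>B x\<close> vanishes, so
  every application of \<open>B\<close> annihilates one more block from the end.\<close>

lemma drift_nilpotent:
  assumes Bs: "\<And>k. k \<in> {1..r} \<Longrightarrow> Bs k \<in> carrier_mat (m (k - 1)) (m k)"
  shows "((*v) (to_cart_mat idx (drift_mat r m Bs)) ^^ Suc r) y = 0"
proof -
  let ?B = "to_cart_mat idx (drift_mat r m Bs)"
  have "block_vec j (((*v) ?B ^^ k) y) = 0\<^sub>v (m j)" if "j \<le> r" "r < j + k" for j k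
    using that
  proof (induction k arbitrary: j)
    case (Suc k)
    show ?case
    proof (cases "j = r")
      case True
      then show ?thesis by (simp add: block_vec_drift_last)
    next
      case False
      then have j: "j < r" using Suc.prems by simp
      have carr: "Bs (Suc j) \<in> carrier_mat (m j) (m (Suc j))" using Bs[of "Suc j"] j by simp
      have "Bs (Suc j) *\<^sub>v 0\<^sub>v (m (Suc j)) = 0\<^sub>v (m j)"
        by (rule eq_vecI) (use carr in auto)
      then show ?thesis
        using Suc.IH[of "Suc j"] Suc.prems j carr by (simp add: block_vec_drift)
    qed
  qed simp
  then show ?thesis by (intro all_block_vecs_zero) (simp del: funpow.simps)
qed

text \<open>If block 0 of all iterates of \<open>w\<close> vanishes, the same holds for \<open>B w\<close>. So block \<open>j\<close> of
  \<open>B w\<close> vanishes by induction on \<open>j\<close>; it is the image of block \<open>j + 1\<close> of \<open>w\<close> under an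
  injective matrix.\<close>

lemma drift_observable:
  assumes Bs: "\<And>k. k \<in> {1..r} \<Longrightarrow> Bs k \<in> carrier_mat (m (k - 1)) (m k)"
    and rank: "\<And>k. k \<in> {1..r} \<Longrightarrow> vec_space.rank (m (k - 1)) (Bs k) = m k"
    and zero: "\<And>k. k \<le> r \<Longrightarrow> block_vec 0 (((*v) (to_cart_mat idx (drift_mat r m Bs)) ^^ k) w) = 0\<^sub>v (m 0)"
  shows "w = 0"
proof -
  let ?B = "to_cart_mat idx (drift_mat r m Bs)"
  have "block_vec j w = 0\<^sub>v (m j)"
    if "j \<le> r" "\<And>k. k \<le> j \<Longrightarrow> block_vec 0 (((*v) ?B ^^ k) w) = 0\<^sub>v (m 0)" for j w
    using that
  proof (induction j arbitrary: w)
    case 0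
    then show ?case using "0.prems"(2)[of 0] by simp
  next
    case (Suc j)
    have carr: "Bs (Suc j) \<in> carrier_mat (m j) (m (Suc j))"
      and rk: "vec_space.rank (m j) (Bs (Suc j)) = m (Suc j)"
      using Bs[of "Suc j"] rank[of "Suc j"] Suc.prems(1) by auto
    have "block_vec j (?B *v w) = 0\<^sub>v (m j)"
    proof (rule Suc.IH)
      show "block_vec 0 (((*v) ?B ^^ k) (?B *v w)) = 0\<^sub>v (m 0)" if "k \<le> j" for k
        using Suc.prems(2)[of "Suc k"] that by (simp add: funpow_swap1)
    qed (use Suc.prems in simp)
    then have "Bs (Suc j) *\<^sub>v block_vec (Suc j) w = 0\<^sub>v (m j)"
      using block_vec_drift[where Bs = Bs and j = j and x = w] carr Suc.prems(1) by simp
    then show ?case by (rule full_column_rank_kernel[OF carr rk block_vec_carrier])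
  qed
  then show ?thesis using zero by (intro all_block_vecs_zero) auto
qed

end

theorem theorem3p6:
  fixes r :: nat and m :: "nat \<Rightarrow> nat"
    and A0 :: "real mat" and Bs :: "nat \<Rightarrow> real mat"
    and idx :: "'n::finite \<Rightarrow> nat"
    and u :: "real ^ 'n \<Rightarrow> real"
  assumes "r \<ge> 1"
    and "\<And>k. k \<in> {1..r} \<Longrightarrow> m k \<le> m (k - 1)"
    and "m r \<ge> 1"
    and "A0 \<in> carrier_mat (m 0) (m 0)"
    and "transpose_mat A0 = A0"
    and "pos_def_mat A0"
    and "\<And>k. k \<in> {1..r} \<Longrightarrow> Bs k \<in> carrier_mat (m (k - 1)) (m k)"
    and "\<And>k. k \<in> {1..r} \<Longrightarrow> vec_space.rank (m (k - 1)) (Bs k) = m k"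
    and "bij_betw idx UNIV {..<total_dim r m}"
    and "C2_function u"
    and "bounded (range u)"
    and "\<And>x. u x > 0"
    and "\<And>x. OU_operator (to_cart_mat idx (diffusion_mat r m A0))
                (to_cart_mat idx (drift_mat r m Bs)) u x = 0"
  shows "u constant_on UNIV"
proof -
  interpret block_coordinates r m idx by standard (rule assms(9))
  let ?A = "to_cart_mat idx (diffusion_mat r m A0)"
  let ?B = "to_cart_mat idx (drift_mat r m Bs)"
  note A0 = assms(4)
  have pd: "scalar_prod v (A0 *\<^sub>v v) > 0" if "v \<in> carrier_vec (m 0)" "v \<noteq> 0\<^sub>v (m 0)" for v
    using assms(6) A0 that by (auto simp: pos_def_mat_def)
  show ?thesis
  proof (rule OU_nilpotent_Liouville[OF _ _ drift_nilpotent _ assms(10,11,13)])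
    show "transpose ?A = ?A"
    proof -
      have "A0 $$ (a, b) = A0 $$ (b, a)" if "a < m 0" "b < m 0" for a b
        using that A0 assms(5) by (metis carrier_matD index_transpose_mat(1))
      then show ?thesis
        by (simp add: Finite_Cartesian_Product.vec_eq_iff transpose_def to_cart_mat_def
            diffusion_mat_entry[OF A0 idx_less idx_less])
    qed
    show "0 \<le> x \<bullet> (?A *v x)" for x
    proof (cases "block_vec 0 x = 0\<^sub>v (m 0)")
      case True
      have "A0 *\<^sub>v 0\<^sub>v (m 0) \<in> carrier_vec (m 0)" using A0 by simp
      then show ?thesis by (simp add: diffusion_quadratic_form[OF A0] True)
    next
      case False
      then show ?thesis using pd[OF block_vec_carrier] by (simp add: diffusion_quadratic_form[OF A0] less_imp_le)
    qed
    show "w = 0" if zero: "\<And>k. k \<le> r \<Longrightarrow> ?A *v ((*v) ?B ^^ k) w = 0" for w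
    proof (rule drift_observable[OF assms(7,8)])
      fix k assume "k \<le> r"
      define y where "y = ((*v) ?B ^^ k) w"
      have "scalar_prod (block_vec 0 y) (A0 *\<^sub>v block_vec 0 y) = 0"
        using zero[OF \<open>k \<le> r\<close>] by (simp add: y_def flip: diffusion_quadratic_form[OF A0])
      then show "block_vec 0 (((*v) ?B ^^ k) w) = 0\<^sub>v (m 0)"
        using pd[OF block_vec_carrier, of y] by (force simp: y_def)
    qed
  qed (rule assms(7))
qed

end
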